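(* For a positive integer vector $B=(b_1,\ldots,b_l)$ define $|B|=\sum_{i=1}^l b_i$ and $\omega(B)=\prod_{i=1}^l \frac{b_i^{b_i}}{b_i!}$. Let $W=(w_{ij})$ be a non-negative real $m\times n$ matrix, let $R_1,\ldots,R_p$ be positive integer $m$-vectors and $C_1,\ldots,C_p$ positive integer $n$-vectors such that $|R_1|=\cdots=|R_p|=|C_1|=\cdots=|C_p|=N$. Let $\alpha_1,\ldots,\alpha_p\ge 0$ with $\alpha_1+\cdots+\alpha_p=1$, and define $R=\sum_{k=1}^p\alpha_kR_k$ and $C=\sum_{k=1}^p\alpha_kC_k$; suppose $R$ and $C$ are positive integer vectors. Then $$\frac{N^N}{N!}\,\frac{T(R,C;W)}{\omega(R)\,\omega(C)}\ \ge\ \prod_{k=1}^p\left(\frac{T(R_k,C_k;W)}{\min\{\omega(R_k),\,\omega(C_k)\}}\right)^{\alpha_k}.$$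
   Context: For a positive integer $m$-vector $R=(r_1,\ldots,r_m)$ and a positive integer $n$-vector $C=(c_1,\ldots,c_n)$ with $\sum_i r_i=\sum_j c_j$, a contingency table with margins $(R,C)$ is an $m\times n$ matrix $D=(d_{ij})$ of non-negative integers with row sums $\sum_j d_{ij}=r_i$ for all $i$ and column sums $\sum_i d_{ij}=c_j$ for all $j$. For a non-negative $m\times n$ matrix $W=(w_{ij})$, $T(R,C;W)=\sum_D\prod_{i,j} w_{ij}^{d_{ij}}$, the sum over all contingency tables $D$ with margins $(R,C)$, with the convention $0^0=1$. *)

theory Defs
  imports "HOL-Analysis.Analysis"
begin

definition cont_tables :: "nat \<Rightarrow> nat \<Rightarrow> (nat \<Rightarrow> nat) \<Rightarrow> (nat \<Rightarrow> nat) \<Rightarrow> (nat \<Rightarrow> nat \<Rightarrow> nat) set" where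
  "cont_tables m n R C = {D. (\<forall>i j. (i \<ge> m \<or> j \<ge> n) \<longrightarrow> D i j = 0)
      \<and> (\<forall>i<m. (\<Sum>j<n. D i j) = R i) \<and> (\<forall>j<n. (\<Sum>i<m. D i j) = C j)}"

(* T(R,C;W) = sum over tables D of prod w_ij ^ d_ij  (with 0^0 = 1, as in HOL's ^) *)
definition T :: "nat \<Rightarrow> nat \<Rightarrow> (nat \<Rightarrow> nat) \<Rightarrow> (nat \<Rightarrow> nat) \<Rightarrow> (nat \<Rightarrow> nat \<Rightarrow> real) \<Rightarrow> real" where
  "T m n R C W = (\<Sum>D\<in>cont_tables m n R C. \<Prod>i<m. \<Prod>j<n. W i j ^ D i j)"

definition vsize :: "nat \<Rightarrow> (nat \<Rightarrow> nat) \<Rightarrow> nat" where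
  "vsize l B = (\<Sum>i<l. B i)"

definition omega :: "nat \<Rightarrow> (nat \<Rightarrow> nat) \<Rightarrow> real" where
  "omega l B = (\<Prod>i<l. real (B i) ^ B i / fact (B i))"

(* real power x^a for x >= 0, a >= 0, with the convention 0^0 = 1 *)
definition rpow :: "real \<Rightarrow> real \<Rightarrow> real" where
  "rpow x a = (if a = 0 then 1 else x powr a)"

end

theory Submission
  imports Defs "HOL-Computational_Algebra.Fundamental_Theorem_Algebra"
begin

text \<open>
  Write \<open>T(R,C;W)\<close> as the integral over positive matrices \<open>x\<close>, against \<open>exp (- \<Sum> x\<^sub>i\<^sub>j)\<close>, of
  \<open>P(R,C;A) = \<Sum>\<^sub>D \<Prod> a\<^sub>i\<^sub>j ^ d\<^sub>i\<^sub>j / d\<^sub>i\<^sub>j!\<close> at \<open>a\<^sub>i\<^sub>j = x\<^sub>i\<^sub>j w\<^sub>i\<^sub>j\<close>. With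
  \<open>q(s,t) = \<Sum> a\<^sub>i\<^sub>j s\<^sub>i t\<^sub>j\<close>, compare \<open>P\<close> with the capacity, the infimum of
  \<open>(q(s,t) / N) ^ N / (s ^ R * t ^ C)\<close> over positive \<open>s, t\<close>. By AM-GM, \<open>P\<close> is at most
  \<open>min (\<omega>(R)) (\<omega>(C))\<close> times the capacity; by Gurvits' form of the van der Waerden bound it is at least
  \<open>N! / N ^ N * \<omega>(R) * \<omega>(C)\<close> times the capacity. The capacity is log-concave jointly in \<open>(A,R,C)\<close>
  because \<open>q\<close> is linear in \<open>A\<close>. The Prekopa--Leindler inequality, applied to one entry of \<open>x\<close> at
  a time, carries the resulting inequality for \<open>P\<close> over to \<open>T\<close>.
\<close>

section \<open>The Prekopa--Leindler inequality for exponential densities\<close>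

text \<open>The capacity bounds concern weights with factorials, which \<open>T\<close> lacks. The
  exponential density removes them, since \<open>x ^ d / d!\<close> has integral 1 against
  \<open>exp (-x)\<close>. The comparison fits Prekopa--Leindler because linearity of
  \<open>q\<close> makes the matrices \<open>x_k * W\<close> combine to
  \<open>(\<Sum> \<alpha> k * x_k) * W\<close>, so the right-hand side is evaluated exactly at the
  arithmetic mean of the points. The two bounds on \<open>P\<close> do not meet, and their gap is
  the constant of the theorem: each \<open>(R_k, C_k)\<close> costs
  \<open>min (\<omega>(R_k)) (\<omega>(C_k))\<close>, while \<open>(R, C)\<close> costs
  \<open>N ^ N / N!\<close> and both omegas. The infimum defining the capacity is never formed. Any
  \<open>\<kappa> \<ge> 0\<close> with
  \<open>\<kappa> * s ^ R * t ^ C \<le> (q(s,t) / N) ^ N\<close> for all positive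
  \<open>s, t\<close> serves in its place. For the lower bound, \<open>P\<close> is read as a
  constant times the \<open>N\<close>-th derivative of \<open>\<Prod> u_i ^ R_i\<close> along the
  columns of \<open>A\<close>, column \<open>j\<close> being used \<open>C j\<close> times.
  Real-rootedness on lines then controls the loss per derivative.\<close>

lemma weighted_AM_GM:
  fixes a x :: "'a \<Rightarrow> real"
  assumes "finite S" and a: "\<And>i. i \<in> S \<Longrightarrow> a i \<ge> 0" and sum1: "sum a S = 1"
    and x: "\<And>i. i \<in> S \<Longrightarrow> x i \<ge> 0"
  shows "(\<Prod>i\<in>S. x i powr a i) \<le> (\<Sum>i\<in>S. a i * x i)"
proof (cases "\<exists>i\<in>S. x i = 0")
  case True
  \<comment> \<open>In HOL \<open>0 powr a\<close> is 0 for every \<open>a\<close>, including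
    \<open>a = 0\<close>.\<close>
  then have "(\<Prod>i\<in>S. x i powr a i) = 0"
    using \<open>finite S\<close> by auto
  then show ?thesis
    by (simp add: sum_nonneg a x)
next
  case False
  then have pos: "x i > 0" if "i \<in> S" for i
    using x[OF that] that by (metis order.not_eq_order_implies_strict)
  have "(\<Sum>i\<in>S. a i * ln (x i)) \<le> ln (\<Sum>i\<in>S. a i *\<^sub>R x i)"
    using assms pos by (intro concave_on_sum[OF _ _ ln_concave]) (auto intro!: Nat.gr0I)
  moreover have "(\<Sum>i\<in>S. a i *\<^sub>R x i) > 0"
  proof -
    obtain j where "j \<in> S" "a j \<noteq> 0"
      using sum1 by (metis sum.neutral zero_neq_one)
    then have "a j *\<^sub>R x j > 0"
      using a[of j] pos[of j] by (simp add: order.not_eq_order_implies_strict)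
    then show ?thesis
      using a pos assms(1) \<open>j \<in> S\<close> by (intro sum_pos2[of _ j]) (auto intro!: mult_nonneg_nonneg less_imp_le[OF pos])
  qed
  ultimately have "exp (\<Sum>i\<in>S. a i * ln (x i)) \<le> (\<Sum>i\<in>S. a i * x i)"
    by (simp add: ln_ge_iff)
  moreover have "(\<Prod>i\<in>S. x i powr a i) = exp (\<Sum>i\<in>S. a i * ln (x i))"
    unfolding exp_sum[OF \<open>finite S\<close>]
    by (intro prod.cong) (use pos in \<open>auto simp: powr_def less_imp_neq[symmetric] simp del: exp_ln dest!: pos\<close>)
  ultimately show ?thesis by simp
qed

lemma weighted_AM_GM_nat:
  fixes r :: "'a \<Rightarrow> nat" and x :: "'a \<Rightarrow> real"
  assumes "finite S" and N: "sum r S = N" and x: "\<And>i. i \<in> S \<Longrightarrow> x i \<ge> 0"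
  shows "(\<Prod>i\<in>S. x i ^ r i) \<le> ((\<Sum>i\<in>S. real (r i) * x i) / N) ^ N"
proof (cases "N = 0 \<or> (\<exists>i\<in>S. r i > 0 \<and> x i = 0)")
  case True
  then show ?thesis
  proof
    assume "N = 0"
    then show ?thesis using N \<open>finite S\<close> by simp
  next
    assume "\<exists>i\<in>S. r i > 0 \<and> x i = 0"
    then have "(\<Prod>i\<in>S. x i ^ r i) = 0"
      using \<open>finite S\<close> by (auto simp: prod_zero_iff)
    then show ?thesis by (simp add: sum_nonneg x)
  qed
next
  case False
  then have "N > 0" by simp
  \<comment> \<open>Entries with exponent 0 may vanish; the value 1 avoids
    \<open>0 powr 0 = 0\<close> and changes neither side, as its weight is 0.\<close>
  define y where "y i = (if r i = 0 then 1 else x i)" for i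
  have y: "y i > 0" if "i \<in> S" for i
  proof -
    have "x i \<noteq> 0 \<or> r i = 0" using False that by auto
    then show ?thesis using x[OF that] by (auto simp: y_def)
  qed
  have "(\<Prod>i\<in>S. y i powr (real (r i) / N)) \<le> (\<Sum>i\<in>S. real (r i) / N * y i)"
    using N \<open>N > 0\<close> y \<open>finite S\<close>
    by (intro weighted_AM_GM) (auto simp: less_imp_le simp flip: sum_divide_distrib of_nat_sum)
  then have "(\<Prod>i\<in>S. y i powr (real (r i) / N)) ^ N \<le> (\<Sum>i\<in>S. real (r i) / N * y i) ^ N"
    by (intro power_mono) (auto intro!: prod_nonneg)
  moreover have "(\<Prod>i\<in>S. y i powr (real (r i) / N)) ^ N = (\<Prod>i\<in>S. x i ^ r i)"
    unfolding prod_power_distrib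
  proof (intro prod.cong refl)
    fix i assume "i \<in> S"
    have "(y i powr (real (r i) / N)) ^ N = y i powr real (r i)"
      using y[OF \<open>i \<in> S\<close>] \<open>N > 0\<close> by (simp add: powr_realpow[symmetric] powr_powr)
    also have "\<dots> = x i ^ r i"
      using y[OF \<open>i \<in> S\<close>] by (auto simp: powr_realpow y_def)
    finally show "(y i powr (real (r i) / N)) ^ N = x i ^ r i" .
  qed
  moreover have "(\<Sum>i\<in>S. real (r i) / N * y i) = (\<Sum>i\<in>S. real (r i) * x i) / N"
    unfolding sum_divide_distrib by (intro sum.cong) (auto simp: y_def)
  ultimately show ?thesis by simp
qed

text \<open>The function is the tail mass beyond \<open>t\<close> of the density
  \<open>exp (- x) * x ^ d / fact d\<close>: the derivatives of the summands telescope, leaving only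
  the top term.\<close>

lemma exp_poly_tail_deriv:
  "((\<lambda>t. exp (- t) * (\<Sum>j\<le>d. t ^ j / fact j)) has_real_derivative
     - (exp (- t) * (t ^ d / fact d))) (at t)"
proof (induction d)
  case 0
  then show ?case by (auto intro!: derivative_eq_intros)
next
  case (Suc d)
  have "((\<lambda>t. exp (- t) * (t ^ Suc d / fact (Suc d))) has_real_derivative
     - (exp (- t) * (t ^ Suc d / fact (Suc d))) + exp (- t) * (real (Suc d) * t ^ d / fact (Suc d))) (at t)"
    by (rule DERIV_cong[OF DERIV_mult[OF DERIV_fun_exp[OF DERIV_minus[OF DERIV_ident]] DERIV_cdivide[OF DERIV_pow]]])
       (simp add: algebra_simps del: fact_Suc)
  moreover have "real (Suc d) * t ^ d / fact (Suc d) = t ^ d / fact d"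
    by (simp del: of_nat_Suc)
  ultimately have "((\<lambda>t. exp (- t) * (t ^ Suc d / fact (Suc d))) has_real_derivative
     - (exp (- t) * (t ^ Suc d / fact (Suc d))) + exp (- t) * (t ^ d / fact d)) (at t)"
    by metis
  from DERIV_add[OF Suc this] show ?case
    by (simp add: algebra_simps del: fact_Suc)
qed

lemma exp_poly_tail_tendsto_0:
  "((\<lambda>t::real. exp (- t) * (\<Sum>j\<le>d. t ^ j / fact j)) \<longlongrightarrow> 0) at_top"
proof -
  have "((\<lambda>t::real. \<Sum>j\<le>d. (t ^ j / exp t) / fact j) \<longlongrightarrow> (\<Sum>j\<le>d. 0 / fact j)) at_top"
    by (intro tendsto_intros tendsto_power_div_exp_0) simp_all
  then show ?thesis
    by (simp add: sum_distrib_left exp_minus field_simps)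
qed

text \<open>
  For a polynomial \<open>f t = (\<Sum>d. a d * t ^ d / fact d)\<close> the integral of \<open>f t * exp (- t)\<close>
  over the positive half-line is \<open>\<Sum>d. a d\<close>, so this is the Prekopa--Leindler inequality for
  exponential densities. The proof is the transport argument; since the tail masses are known
  explicitly, no integral occurs: \<open>\<tau> k u\<close> is the point beyond which the fraction \<open>u\<close> of the mass lies.
\<close>

lemma prekopa_leindler_exp:
  fixes a :: "'k \<Rightarrow> nat \<Rightarrow> real" and b :: "nat \<Rightarrow> real" and \<alpha> :: "'k \<Rightarrow> real"
  assumes K: "finite K"
    and \<alpha>: "\<And>k. k \<in> K \<Longrightarrow> \<alpha> k > 0" "sum \<alpha> K = 1"
    and a: "\<And>k d. k \<in> K \<Longrightarrow> a k d \<ge> 0" "\<And>k. k \<in> K \<Longrightarrow> (\<Sum>d\<le>M. a k d) > 0"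
    and b: "\<And>d. b d \<ge> 0"
    and ineq: "\<And>t. (\<And>k. k \<in> K \<Longrightarrow> t k > 0) \<Longrightarrow>
      (\<Prod>k\<in>K. (\<Sum>d\<le>M. a k d * (t k ^ d / fact d)) powr \<alpha> k)
        \<le> (\<Sum>d\<le>M. b d * ((\<Sum>k\<in>K. \<alpha> k * t k) ^ d / fact d))"
  shows "(\<Prod>k\<in>K. (\<Sum>d\<le>M. a k d) powr \<alpha> k) \<le> (\<Sum>d\<le>M. b d)"
proof -
  define tail where "tail c t = (\<Sum>d\<le>M. c d * (exp (- t) * (\<Sum>j\<le>d. t ^ j / fact j)))"
    for c :: "nat \<Rightarrow> real" and t :: real
  define f where "f c t = (\<Sum>d\<le>M. c d * (t ^ d / fact d))" for c :: "nat \<Rightarrow> real" and t :: real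
  define I where "I k = (\<Sum>d\<le>M. a k d)" for k
  have tail_deriv: "(tail c has_real_derivative - (exp (- t) * f c t)) (at t)" for c t
    unfolding tail_def[abs_def]
    by (rule DERIV_cong, (rule DERIV_sum DERIV_cmult exp_poly_tail_deriv)+)
       (simp add: f_def sum_distrib_left sum_negf algebra_simps)
  have tail_cont: "isCont (tail c) t" for c t
    using tail_deriv DERIV_isCont by blast
  have tail_lim: "(tail c \<longlongrightarrow> 0) at_top" for c
  proof -
    have "((\<lambda>t. tail c t) \<longlongrightarrow> (\<Sum>d\<le>M. c d * 0)) at_top"
      unfolding tail_def by (intro tendsto_intros exp_poly_tail_tendsto_0)
    then show ?thesis by simp
  qed
  have sum0: "(\<Sum>j\<le>d. 0 ^ j / fact j) = (1::real)" for d
  proof -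
    have "(\<Sum>j\<le>d. 0 ^ j / fact j) = (\<Sum>j\<le>d. if j = 0 then 1 else (0::real))"
      by (intro sum.cong) auto
    then show ?thesis by simp
  qed
  have tail_0: "tail c 0 = sum c {..M}" for c
    by (simp add: tail_def sum0)
  have I: "I k > 0" if "k \<in> K" for k using a(2)[OF that] by (simp add: I_def)
  have f_pos: "f (a k) t > 0" if kt: "k \<in> K" "t > 0" for k t
  proof -
    obtain d where "d \<le> M" "a k d \<noteq> 0"
      using a(2)[OF kt(1)] by (metis atMost_iff less_irrefl sum.neutral)
    then have "a k d > 0" using a(1)[OF kt(1), of d] by linarith
    show ?thesis unfolding f_def
    proof (rule sum_pos2[of _ d])
      show "0 < a k d * (t ^ d / fact d)" using \<open>a k d > 0\<close> kt by simp
      show "0 \<le> a k i * (t ^ i / fact i)" for i using a(1)[OF kt(1), of i] kt by simp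
    qed (use \<open>d \<le> M\<close> in auto)
  qed
  have tail_less: "tail (a k) y < tail (a k) x" if "k \<in> K" "0 \<le> x" "x < y" for k x y
  proof (rule DERIV_neg_imp_decreasing_open[OF \<open>x < y\<close>])
    fix z assume "x < z" "z < y"
    then show "\<exists>D. (tail (a k) has_real_derivative D) (at z) \<and> D < 0"
      using tail_deriv[of "a k" z] f_pos[OF that(1), of z] that by fastforce
  next
    show "continuous_on {x..y} (tail (a k))"
      by (intro continuous_at_imp_continuous_on ballI tail_cont)
  qed
  have ex: "\<exists>t>0. tail (a k) t = u * I k" if ku: "k \<in> K" "0 < u" "u < 1" for k u
  proof -
    have "\<forall>\<^sub>F t in at_top. tail (a k) t < u * I k"
      using order_tendstoD(2)[OF tail_lim, of "u * I k" "a k"] ku I by simp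
    then obtain s where s: "\<And>t. t \<ge> s \<Longrightarrow> tail (a k) t < u * I k"
      by (auto simp: eventually_at_top_linorder)
    have 0: "tail (a k) 0 > u * I k"
      using ku I[OF ku(1)] by (simp add: tail_0 flip: I_def)
    have "\<exists>t\<ge>0. t \<le> max s 0 \<and> tail (a k) t = u * I k"
      using s[of "max s 0"] 0 by (intro IVT2) (auto intro: tail_cont)
    then show ?thesis
      using 0 by (metis less_irrefl less_le)
  qed
  define \<tau> where "\<tau> k u = (SOME t. t > 0 \<and> tail (a k) t = u * I k)" for k u
  have \<tau>: "\<tau> k u > 0" "tail (a k) (\<tau> k u) = u * I k" if "k \<in> K" "0 < u" "u < 1" for k u
    using someI_ex[OF ex[OF that, folded Bex_def, unfolded Bex_def]] by (auto simp: \<tau>_def)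
  have \<tau>_inv: "\<tau> k (tail (a k) t / I k) = t" if "k \<in> K" "t > 0" "tail (a k) t > 0" for k t
  proof -
    have lt: "tail (a k) t < I k"
      using tail_less[OF that(1), of 0 t] that by (simp add: tail_0 I_def)
    have "tail (a k) (\<tau> k (tail (a k) t / I k)) = tail (a k) t" "\<tau> k (tail (a k) t / I k) > 0"
      using \<tau>[OF that(1), of "tail (a k) t / I k"] that I[OF that(1)] lt by auto
    then show ?thesis
      using tail_less[OF that(1)] that(2) by (metis less_irrefl linorder_neqE_linordered_idom less_imp_le)
  qed
  have \<tau>_deriv: "(\<tau> k has_real_derivative - (I k * exp (\<tau> k u) / f (a k) (\<tau> k u))) (at u)"
    if ku: "k \<in> K" "0 < u" "u < 1" for k u
  proof -
    note Tu = \<tau>[OF ku]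
    \<comment> \<open>Level \<open>u / 2\<close> gives a point to the right of
      \<open>\<tau> k u\<close> whose tail is still positive, so \<open>\<tau>_inv\<close> holds on
      a whole neighbourhood.\<close>
    obtain s where s: "s > 0" "tail (a k) s = u / 2 * I k"
      using ex[OF ku(1), of "u/2"] ku by auto
    have s': "tail (a k) s > 0" unfolding s(2) using ku I[OF ku(1)] by simp
    have "isCont (\<tau> k) (tail (a k) (\<tau> k u) / I k)"
    proof (rule isCont_inverse_function2[where f = "\<lambda>t. tail (a k) t / I k" and a = "\<tau> k u / 2" and b = s])
      show "\<tau> k u / 2 < \<tau> k u" using Tu by simp
      show "\<tau> k u < s"
      proof (rule ccontr)
        assume "\<not> ?thesis"
        then have "tail (a k) s \<ge> tail (a k) (\<tau> k u)"
          using tail_less[OF ku(1), of s "\<tau> k u"] s by (cases "s = \<tau> k u") auto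
        then show False using s Tu ku I[OF ku(1)] by simp
      qed
      show "\<tau> k (tail (a k) z / I k) = z" if "\<tau> k u / 2 \<le> z" "z \<le> s" for z
      proof (rule \<tau>_inv[OF \<open>k \<in> K\<close>])
        show "z > 0" using that Tu by simp
        then show "tail (a k) z > 0"
          using tail_less[OF \<open>k \<in> K\<close>, of z s] that s' by (cases "z = s") auto
      qed
      show "isCont (\<lambda>t. tail (a k) t / I k) z" for z
        using I[OF \<open>k \<in> K\<close>] by (intro continuous_intros tail_cont) simp
    qed
    then have cont: "isCont (\<tau> k) u" using Tu I[OF ku(1)] by simp
    have "(\<tau> k has_real_derivative inverse (- (exp (- \<tau> k u) * f (a k) (\<tau> k u)) / I k)) (at u)"
    proof (rule DERIV_inverse_function[where f = "\<lambda>t. tail (a k) t / I k" and a = 0 and b = 1])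
      show "((\<lambda>t. tail (a k) t / I k) has_real_derivative - (exp (- \<tau> k u) * f (a k) (\<tau> k u)) / I k) (at (\<tau> k u))"
        by (rule DERIV_cdivide[OF tail_deriv])
      show "- (exp (- \<tau> k u) * f (a k) (\<tau> k u)) / I k \<noteq> 0"
        using I[OF ku(1)] f_pos[OF ku(1) Tu(1)] by simp
      show "tail (a k) (\<tau> k y) / I k = y" if "0 < y" "y < 1" for y
        using \<tau>[OF \<open>k \<in> K\<close> that] I[OF \<open>k \<in> K\<close>] by simp
    qed (use ku cont in auto)
    then show ?thesis
      by (simp add: exp_minus field_simps)
  qed
  define P where "P = (\<Prod>k\<in>K. I k powr \<alpha> k)"
  define z where "z u = (\<Sum>k\<in>K. \<alpha> k * \<tau> k u)" for u
  have z_deriv: "(z has_real_derivative - (\<Sum>k\<in>K. \<alpha> k * (I k * exp (\<tau> k u) / f (a k) (\<tau> k u)))) (at u)"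
    if "0 < u" "u < 1" for u
    unfolding z_def
    by (rule DERIV_cong, (rule DERIV_sum DERIV_cmult \<tau>_deriv that | assumption)+) (simp add: sum_negf)
  \<comment> \<open>The heart of the transport: the mass of \<open>b\<close> beyond the averaged
    point \<open>z u\<close> grows at rate at least \<open>P\<close>. AM-GM bounds the speed of
    \<open>z\<close> by a geometric mean in which the densities at the \<open>\<tau> k u\<close>
    cancel against \<open>ineq\<close>.\<close>
  have \<phi>_deriv: "\<exists>D. ((\<lambda>u. tail b (z u)) has_real_derivative D) (at u) \<and> P \<le> D" if u: "0 < u" "u < 1" for u
  proof (intro exI conjI)
    show "((\<lambda>u. tail b (z u)) has_real_derivative
        - (exp (- z u) * f b (z u)) * - (\<Sum>k\<in>K. \<alpha> k * (I k * exp (\<tau> k u) / f (a k) (\<tau> k u)))) (at u)"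
      by (rule DERIV_chain2[OF tail_deriv z_deriv[OF u]])
    have "P = (\<Prod>k\<in>K. exp (- (\<alpha> k * \<tau> k u)) * f (a k) (\<tau> k u) powr \<alpha> k
                    * (I k * exp (\<tau> k u) / f (a k) (\<tau> k u)) powr \<alpha> k)"
      unfolding P_def
    proof (intro prod.cong refl)
      fix k assume k: "k \<in> K"
      have "f (a k) (\<tau> k u) > 0" using f_pos \<tau>[OF k u] k by blast
      then show "I k powr \<alpha> k = exp (- (\<alpha> k * \<tau> k u)) * f (a k) (\<tau> k u) powr \<alpha> k
                    * (I k * exp (\<tau> k u) / f (a k) (\<tau> k u)) powr \<alpha> k"
        using I[OF k] by (simp add: powr_divide powr_mult exp_powr_real exp_minus field_simps)
    qed
    also have "\<dots> = exp (- z u) * (\<Prod>k\<in>K. f (a k) (\<tau> k u) powr \<alpha> k)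
                 * (\<Prod>k\<in>K. (I k * exp (\<tau> k u) / f (a k) (\<tau> k u)) powr \<alpha> k)"
      by (simp add: prod.distrib z_def exp_sum K flip: sum_negf)
    also have "\<dots> \<le> exp (- z u) * f b (z u) * (\<Sum>k\<in>K. \<alpha> k * (I k * exp (\<tau> k u) / f (a k) (\<tau> k u)))"
    proof (intro mult_mono mult_left_mono)
      show "(\<Prod>k\<in>K. f (a k) (\<tau> k u) powr \<alpha> k) \<le> f b (z u)"
        unfolding f_def z_def using \<tau> u by (intro ineq) blast
      show "(\<Prod>k\<in>K. (I k * exp (\<tau> k u) / f (a k) (\<tau> k u)) powr \<alpha> k)
          \<le> (\<Sum>k\<in>K. \<alpha> k * (I k * exp (\<tau> k u) / f (a k) (\<tau> k u)))"
        using K \<alpha> I f_pos \<tau> u by (intro weighted_AM_GM) (auto intro!: mult_nonneg_nonneg divide_nonneg_nonneg less_imp_le)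
      have "z u \<ge> 0" unfolding z_def
        using \<alpha> \<tau> u by (intro sum_nonneg mult_nonneg_nonneg) (auto intro: less_imp_le)
      then show "0 \<le> exp (- z u) * f b (z u)"
        unfolding f_def using b by (intro mult_nonneg_nonneg sum_nonneg divide_nonneg_nonneg) auto
    qed (auto intro!: prod_nonneg)
    finally show "P \<le> - (exp (- z u) * f b (z u)) * - (\<Sum>k\<in>K. \<alpha> k * (I k * exp (\<tau> k u) / f (a k) (\<tau> k u)))"
      by simp
  qed
  have z_nonneg: "z u \<ge> 0" if "0 < u" "u < 1" for u
    unfolding z_def using \<alpha> \<tau> that by (intro sum_nonneg mult_nonneg_nonneg) (auto intro: less_imp_le)
  have tail_nonneg: "tail b t \<ge> 0" if "t \<ge> 0" for t
    unfolding tail_def using b that by (intro sum_nonneg mult_nonneg_nonneg divide_nonneg_nonneg) auto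
  have f_nonneg: "f b t \<ge> 0" if "t \<ge> 0" for t
    unfolding f_def using b that by (intro sum_nonneg mult_nonneg_nonneg divide_nonneg_nonneg) auto
  have tail_le: "tail b t \<le> sum b {..M}" if "t \<ge> 0" for t
  proof -
    have "tail b t \<le> tail b 0"
      using that
      by (rule DERIV_nonpos_imp_nonincreasing)
         (metis tail_deriv f_nonneg exp_ge_zero mult_nonneg_nonneg neg_le_0_iff_le)
    then show ?thesis by (simp add: tail_0)
  qed
  \<comment> \<open>\<open>\<tau>\<close> is controlled only on the open interval from 0 to 1, so
    both ends are cut off.\<close>
  have key: "(1 - 2 * \<delta>) * P \<le> sum b {..M}" if \<delta>: "0 < \<delta>" "\<delta> < 1/2" for \<delta>
  proof -
    have "tail b (z \<delta>) - P * \<delta> \<le> tail b (z (1 - \<delta>)) - P * (1 - \<delta>)"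
    proof (rule DERIV_nonneg_imp_nondecreasing[where f = "\<lambda>u. tail b (z u) - P * u"])
      show "\<delta> \<le> 1 - \<delta>" using \<delta> by simp
      fix u assume "\<delta> \<le> u" "u \<le> 1 - \<delta>"
      then obtain D where D: "((\<lambda>u. tail b (z u)) has_real_derivative D) (at u)" "P \<le> D"
        using \<phi>_deriv[of u] \<delta> by auto
      have "((\<lambda>u. tail b (z u) - P * u) has_real_derivative D - P) (at u)"
        using D(1) by (auto intro!: derivative_eq_intros)
      then show "\<exists>y. ((\<lambda>u. tail b (z u) - P * u) has_real_derivative y) (at u) \<and> 0 \<le> y"
        using D(2) by (intro exI[of _ "D - P"]) simp
    qed
    moreover have "tail b (z \<delta>) \<ge> 0" "tail b (z (1 - \<delta>)) \<le> sum b {..M}"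
      using \<delta> by (auto intro!: tail_nonneg tail_le z_nonneg)
    ultimately show ?thesis by (simp add: algebra_simps)
  qed
  have "P \<le> sum b {..M}"
  proof (rule ccontr)
    assume "\<not> ?thesis"
    then have lt: "sum b {..M} < P" by simp
    have "0 \<le> sum b {..M}" using b by (intro sum_nonneg) auto
    \<comment> \<open>Chosen so that \<open>(1 - 2 * \<delta>) * P\<close> is the midpoint of
      \<open>P\<close> and \<open>sum b {..M}\<close>, contradicting \<open>key\<close>.\<close>
    define \<delta> where "\<delta> = (P - sum b {..M}) / (4 * P)"
    have "P > 0" using lt \<open>0 \<le> sum b {..M}\<close> by simp
    then have "0 < \<delta>" "\<delta> < 1/2" "\<delta> * P = (P - sum b {..M}) / 4"
      using lt \<open>0 \<le> sum b {..M}\<close> by (auto simp: \<delta>_def field_simps)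
    then show False using key[of \<delta>] lt by (simp add: algebra_simps)
  qed
  then show ?thesis by (simp add: P_def I_def)
qed

section \<open>Directional derivatives of products of powers\<close>

text \<open>The iterated derivative of the monomial \<open>\<Prod>i\<in>S. u i ^ R i\<close> in the directions \<open>vs\<close>.\<close>

primrec pdir :: "'i set \<Rightarrow> ('i \<Rightarrow> 'a) list \<Rightarrow> ('i \<Rightarrow> nat) \<Rightarrow> ('i \<Rightarrow> 'a) \<Rightarrow> 'a::comm_semiring_1" where
  "pdir S [] R u = (\<Prod>i\<in>S. u i ^ R i)"
| "pdir S (v # vs) R u = (\<Sum>i\<in>S. of_nat (R i) * v i * pdir S vs (R(i := R i - 1)) u)"

lemma sum_fun_upd_pred:
  fixes R :: "'i \<Rightarrow> nat"
  assumes "finite S" "i \<in> S" "R i > 0"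
  shows "sum (R(i := R i - 1)) S = sum R S - 1" "sum R S > 0"
proof -
  have "sum R S = R i + sum R (S - {i})"
    using assms by (simp add: sum.remove)
  moreover have "sum (R(i := R i - 1)) S = R i - 1 + sum R (S - {i})"
    unfolding sum.remove[OF assms(1,2)] by (intro arg_cong2[of _ _ _ _ "(+)"] sum.cong) auto
  ultimately show "sum (R(i := R i - 1)) S = sum R S - 1" "sum R S > 0"
    using assms by auto
qed

text \<open>The coefficient is \<open>R i * R j\<close> off the diagonal and
  \<open>R i * (R i - 1)\<close> on it, symmetric either way. This lets a derivative along a line be
  recorded at the head of the list of directions.\<close>

lemma pdir_swap:
  "pdir S (v # w # vs) R u = pdir S (w # v # vs) R u"
proof -
  have "pdir S (v # w # vs) R u = (\<Sum>i\<in>S. \<Sum>j\<in>S. of_nat (R i * (R(i := R i - 1)) j) * (v i * w j) *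
          pdir S vs (R(i := R i - 1, j := (R(i := R i - 1)) j - 1)) u)"
    by (simp add: sum_distrib_left mult_ac del: fun_upd_apply)
  also have "\<dots> = (\<Sum>i\<in>S. \<Sum>j\<in>S. of_nat (R j * (R(j := R j - 1)) i) * (w j * v i) *
          pdir S vs (R(j := R j - 1, i := (R(j := R j - 1)) i - 1)) u)"
    by (intro sum.cong refl) (auto simp: mult_ac fun_upd_twist)
  also have "\<dots> = pdir S (w # v # vs) R u"
    by (subst sum.swap) (simp add: sum_distrib_left mult_ac del: fun_upd_apply)
  finally show ?thesis .
qed

lemma pdir_of_real:
  "pdir S (map (\<lambda>v i. of_real (v i)) vs) R (\<lambda>i. of_real (u i)) = of_real (pdir S vs R u)"
  by (induction vs arbitrary: R) simp_all

lemma pdir_scale: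
  assumes "finite S" "length vs \<le> sum R S"
  shows "pdir S vs R (\<lambda>i. c * u i) = c ^ (sum R S - length vs) * pdir S vs R u"
  using assms(2)
proof (induction vs arbitrary: R)
  case Nil
  then show ?case by (simp add: power_mult_distrib prod.distrib power_sum)
next
  case (Cons v vs)
  have "of_nat (R i) * v i * pdir S vs (R(i := R i - 1)) (\<lambda>i. c * u i) =
        c ^ (sum R S - length (v # vs)) * (of_nat (R i) * v i * pdir S vs (R(i := R i - 1)) u)"
    if "i \<in> S" for i
  proof (cases "R i = 0")
    case False
    then have "sum (R(i := R i - 1)) S = sum R S - 1"
      using sum_fun_upd_pred[OF assms(1) that, of R] by simp
    then show ?thesis
      using Cons.IH[of "R(i := R i - 1)"] Cons.prems by (simp add: mult_ac del: fun_upd_apply)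
  qed simp
  then show ?case by (simp add: sum_distrib_left)
qed

lemma pdir_pos:
  fixes u :: "'i \<Rightarrow> real"
  assumes "finite S" "length vs \<le> sum R S" "\<And>v i. v \<in> set vs \<Longrightarrow> i \<in> S \<Longrightarrow> v i > 0"
    and u: "\<And>i. i \<in> S \<Longrightarrow> u i > 0"
  shows "pdir S vs R u > 0"
  using assms(2,3)
proof (induction vs arbitrary: R)
  case Nil
  then show ?case using u by (auto intro!: prod_pos)
next
  case (Cons v vs)
  have pos: "pdir S vs (R(i := R i - 1)) u > 0" if "i \<in> S" "R i > 0" for i
    using Cons.prems sum_fun_upd_pred(1)[where R = R, OF assms(1) that] by (intro Cons.IH) auto
  have "sum R S \<noteq> 0" using Cons.prems by auto
  then obtain i where i: "i \<in> S" "R i > 0"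
    by (metis gr0I sum.neutral)
  show ?case unfolding pdir.simps
  proof (rule sum_pos2[of _ i])
    show "0 < of_nat (R i) * v i * pdir S vs (R(i := R i - 1)) u"
      using i pos Cons.prems by simp
    show "0 \<le> of_nat (R j) * v j * pdir S vs (R(j := R j - 1)) u" if "j \<in> S" for j
      using pos[of j] that Cons.prems(2)[of v j] by (cases "R j = 0") (auto intro!: mult_nonneg_nonneg)
  qed (use assms i in auto)
qed

text \<open>Restricting \<open>pdir\<close> to the line \<open>u + z v\<close> yields a polynomial in \<open>z\<close>; since it only uses ring
  operations, this polynomial is an instance of \<open>pdir\<close> over the polynomial ring.\<close>

definition pdir_line :: "'i set \<Rightarrow> ('i \<Rightarrow> 'a) list \<Rightarrow> ('i \<Rightarrow> nat) \<Rightarrow> ('i \<Rightarrow> 'a) \<Rightarrow> ('i \<Rightarrow> 'a) \<Rightarrow> 'a::{idom,ring_char_0} poly" where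
  "pdir_line S vs R u v = pdir S (map (\<lambda>w i. [:w i:]) vs) R (\<lambda>i. [:u i, v i:])"

lemma poly_pdir_line:
  "poly (pdir_line S vs R u v) z = pdir S vs R (\<lambda>i. u i + z * v i)"
  unfolding pdir_line_def
  by (induction vs arbitrary: R) (simp_all add: poly_prod poly_sum mult_ac)

lemma of_nat_mult_poly: "of_nat n * p = smult (of_nat n) (p :: 'a::comm_semiring_1 poly)"
  by (simp add: of_nat_poly)

lemma pderiv_sum: "pderiv (sum f A) = (\<Sum>x\<in>A. pderiv (f x))"
  by (induction A rule: infinite_finite_induct) (simp_all add: pderiv_add)

lemma pderiv_pdir_line:
  assumes "finite S"
  shows "pderiv (pdir_line S vs R u v) = pdir_line S (v # vs) R u v"
  unfolding pdir_line_def
proof (induction vs arbitrary: R)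
  case Nil
  have "pderiv (\<Prod>i\<in>S. [:u i, v i:] ^ R i) =
      (\<Sum>i\<in>S. (\<Prod>j\<in>S - {i}. [:u j, v j:] ^ R j) * (of_nat (R i) * [:v i:] * [:u i, v i:] ^ (R i - 1)))"
    unfolding pderiv_prod by (intro sum.cong refl) (simp add: pderiv_power pderiv_pCons mult_ac of_nat_mult_poly)
  also have "\<dots> = (\<Sum>i\<in>S. of_nat (R i) * [:v i:] * (\<Prod>j\<in>S. [:u j, v j:] ^ (R(i := R i - 1)) j))"
  proof (intro sum.cong refl)
    fix i assume i: "i \<in> S"
    have "(\<Prod>j\<in>S. [:u j, v j:] ^ (R(i := R i - 1)) j) =
        [:u i, v i:] ^ (R i - 1) * (\<Prod>j\<in>S - {i}. [:u j, v j:] ^ R j)"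
      unfolding prod.remove[OF assms i] by (intro arg_cong2[of _ _ _ _ "(*)"] prod.cong) auto
    then show "(\<Prod>j\<in>S - {i}. [:u j, v j:] ^ R j) * (of_nat (R i) * [:v i:] * [:u i, v i:] ^ (R i - 1)) =
        of_nat (R i) * [:v i:] * (\<Prod>j\<in>S. [:u j, v j:] ^ (R(i := R i - 1)) j)"
      by (simp add: mult_ac del: fun_upd_apply)
  qed
  finally show ?case by simp
next
  case (Cons w vs)
  let ?c = "\<lambda>w i. [:w i:]"
  have "pderiv (pdir S (map ?c (w # vs)) R (\<lambda>i. [:u i, v i:])) =
      (\<Sum>i\<in>S. of_nat (R i) * [:w i:] * pdir S (map ?c (v # vs)) (R(i := R i - 1)) (\<lambda>i. [:u i, v i:]))"
    using Cons.IH
    by (simp add: pderiv_sum of_nat_mult_poly pderiv_smult mult.assoc del: fun_upd_apply)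
  also have "\<dots> = pdir S (map ?c (w # v # vs)) R (\<lambda>i. [:u i, v i:])"
    by simp
  also have "\<dots> = pdir S (map ?c (v # w # vs)) R (\<lambda>i. [:u i, v i:])"
    by (simp only: list.map pdir_swap)
  finally show ?case .
qed

lemma coeff_0_pdir_line: "coeff (pdir_line S vs R u v) 0 = pdir S vs R u"
  using poly_pdir_line[of S vs R u v 0] by (simp add: poly_0_coeff_0)

lemma coeff_1_pdir_line: "finite S \<Longrightarrow> coeff (pdir_line S vs R u v) 1 = pdir S (v # vs) R u"
  using coeff_0_pdir_line[of S "v # vs" R u v] pderiv_pdir_line[of S vs R u v]
    coeff_pderiv[of "pdir_line S vs R u v" 0] by simp

lemma coeff_mult_at_bound:
  fixes p q :: "'a::comm_semiring_0 poly"
  assumes "degree p \<le> a" "degree q \<le> b"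
  shows "coeff (p * q) (a + b) = coeff p a * coeff q b"
proof -
  have "coeff p i * coeff q (a + b - i) = 0" if "i \<noteq> a" "i \<le> a + b" for i
    using that assms by (cases "i < a") (auto simp: coeff_eq_0)
  then have "(\<Sum>i\<le>a + b. coeff p i * coeff q (a + b - i)) = (\<Sum>i\<le>a + b. if i = a then coeff p a * coeff q b else 0)"
    by (intro sum.cong) auto
  then show ?thesis by (simp add: coeff_mult)
qed

lemma coeff_prod_linear_power:
  assumes "finite S"
  shows "degree (\<Prod>i\<in>S. [:u i, v i:] ^ R i) \<le> sum R S \<and>
    coeff (\<Prod>i\<in>S. [:u i, v i:] ^ R i) (sum R S) = (\<Prod>i\<in>S. v i ^ R i)"
proof -
  have pow: "degree ([:a, b:] ^ n) \<le> n \<and> coeff ([:a, b:] ^ n) n = b ^ n" for a b :: 'b and n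
  proof (induction n)
    case (Suc n)
    then show ?case
      using coeff_mult_at_bound[of "[:a, b:]" 1 "[:a, b:] ^ n" n] degree_mult_le[of "[:a, b:]" "[:a, b:] ^ n"]
        degree_pCons_le[of a "[:b:]"] by auto
  qed simp
  show ?thesis using assms
  proof (induction S)
    case (insert x S)
    then show ?case
      using coeff_mult_at_bound[of "[:u x, v x:] ^ R x" "R x" "\<Prod>i\<in>S. [:u i, v i:] ^ R i" "sum R S"]
        pow[of "u x" "v x" "R x"] degree_mult_le[of "[:u x, v x:] ^ R x" "\<Prod>i\<in>S. [:u i, v i:] ^ R i"]
      by auto
  qed simp
qed

text \<open>As \<open>z\<close> grows, \<open>u + z v\<close> is dominated by \<open>z v\<close>, so
  homogeneity makes the top coefficient the value at \<open>v\<close>. For positive directions and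
  \<open>v\<close> this value is positive, which fixes the degree.\<close>

lemma degree_pdir_line:
  assumes "finite S" "length vs \<le> sum R S"
  shows "degree (pdir_line S vs R u v) \<le> sum R S - length vs \<and>
    coeff (pdir_line S vs R u v) (sum R S - length vs) = pdir S vs R v"
  unfolding pdir_line_def using assms(2)
proof (induction vs arbitrary: R)
  case Nil
  then show ?case using coeff_prod_linear_power[OF assms(1)] by auto
next
  case (Cons w vs)
  let ?n = "sum R S - length (w # vs)"
  let ?q = "\<lambda>i. pdir S (map (\<lambda>w i. [:w i:]) vs) (R(i := R i - 1)) (\<lambda>i. [:u i, v i:])"
  have eq: "of_nat (R i) * [:w i:] * ?q i = smult (of_nat (R i) * w i) (?q i)" for i
    by (simp add: of_nat_poly mult.commute)
  have *: "degree (smult (of_nat (R i) * w i) (?q i)) \<le> ?n \<and>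
      coeff (smult (of_nat (R i) * w i) (?q i)) ?n = of_nat (R i) * w i * pdir S vs (R(i := R i - 1)) v"
    if "i \<in> S" for i
  proof (cases "R i = 0")
    case False
    then show ?thesis
      using Cons.IH[of "R(i := R i - 1)"] Cons.prems sum_fun_upd_pred[OF assms(1) that, of R]
        degree_smult_le[of "of_nat (R i) * w i" "?q i"] by (auto simp del: fun_upd_apply intro: order_trans[OF degree_smult_le])
  qed simp
  have "pdir S (map (\<lambda>w i. [:w i:]) (w # vs)) R (\<lambda>i. [:u i, v i:]) =
      (\<Sum>i\<in>S. smult (of_nat (R i) * w i) (?q i))"
    by (simp only: list.map pdir.simps eq)
  then show ?case
    using * assms(1) by (simp only: coeff_sum degree_sum_le pdir.simps cong: sum.cong)
qed

text \<open>Normalising the factors at 0, with \<open>\<rho> i\<close> the negative reciprocal of a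
  root, makes the logarithmic derivative at 0 the plain sum of the \<open>\<rho> i\<close>.\<close>

lemma complex_poly_factor_at_0:
  fixes p :: "complex poly"
  assumes p0: "coeff p 0 \<noteq> 0"
  obtains \<rho> where "\<And>z. poly p z = coeff p 0 * (\<Prod>i<degree p. 1 + \<rho> i * z)"
    "coeff p 1 = coeff p 0 * (\<Sum>i<degree p. \<rho> i)"
    "\<And>i. i < degree p \<Longrightarrow> \<rho> i \<noteq> 0 \<and> poly p (- (1 / \<rho> i)) = 0"
proof -
  obtain root where root: "smult (lead_coeff p) (\<Prod>i<degree p. [:- root i, 1:]) = p"
    by (rule complex_poly_decompose')
  have p: "poly p z = lead_coeff p * (\<Prod>i<degree p. z - root i)" for z
    by (subst root[symmetric]) (simp add: poly_prod)
  have c0: "coeff p 0 = lead_coeff p * (\<Prod>i<degree p. - root i)"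
    using p[of 0] by (simp add: poly_0_coeff_0)
  have nz: "root i \<noteq> 0" if "i < degree p" for i
    using c0 p0 that by auto
  define \<rho> where "\<rho> i = - (1 / root i)" for i
  have 1: "poly p z = coeff p 0 * (\<Prod>i<degree p. 1 + \<rho> i * z)" for z
    unfolding p c0 mult.assoc prod.distrib[symmetric] \<rho>_def
    by (intro arg_cong2[of _ _ _ _ "(*)"] refl prod.cong) (use nz in \<open>auto simp: field_simps\<close>)
  define q where "q = smult (coeff p 0) (\<Prod>i<degree p. [:1, \<rho> i:])"
  have "poly q = poly p"
    unfolding q_def by (intro ext) (simp add: 1 poly_prod mult.commute)
  then have "p = q" by (simp add: poly_eq_poly_eq_iff)
  have "poly (pderiv q) 0 = coeff p 0 * (\<Sum>i<degree p. \<rho> i)"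
    by (simp add: q_def pderiv_smult pderiv_prod pderiv_pCons poly_sum poly_prod)
  then have 2: "coeff p 1 = coeff p 0 * (\<Sum>i<degree p. \<rho> i)"
    using \<open>p = q\<close> coeff_pderiv[of q 0] by (simp add: poly_0_coeff_0)
  have 3: "\<rho> i \<noteq> 0 \<and> poly p (- (1 / \<rho> i)) = 0" if "i < degree p" for i
    using that nz[OF that] unfolding p by (auto simp: \<rho>_def)
  show ?thesis using that 1 2 3 by blast
qed

text \<open>Gauss--Lucas at the origin: the logarithmic derivative at 0 of a polynomial whose roots have
  negative real part has positive real part.\<close>

lemma pdir_nonzero:
  fixes u :: "'i \<Rightarrow> complex" and vs :: "('i \<Rightarrow> real) list"
  assumes "finite S" "length vs \<le> sum R S" "\<And>v i. v \<in> set vs \<Longrightarrow> i \<in> S \<Longrightarrow> v i > 0"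
    and u: "\<And>i. i \<in> S \<Longrightarrow> Re (u i) > 0"
  shows "pdir S (map (\<lambda>v i. of_real (v i)) vs) R u \<noteq> 0"
  using assms(2,3) u
proof (induction vs arbitrary: u)
  case Nil
  then show ?case using assms(1) by force
next
  case (Cons v vs)
  define c where "c v i = complex_of_real (v i)" for v :: "'i \<Rightarrow> real" and i
  define p where "p = pdir_line S (map c vs) R u (c v)"
  \<comment> \<open>For \<open>Re z \<ge> 0\<close> the point \<open>u + z v\<close> stays in the
    right half-plane, where the induction hypothesis forbids zeros.\<close>
  have root: "Re z < 0" if "poly p z = 0" for z
  proof (rule ccontr)
    assume "\<not> ?thesis"
    then have "0 < Re (u i) + Re z * v i" if "i \<in> S" for i
      using Cons.prems that by (intro add_pos_nonneg mult_nonneg_nonneg) (auto intro: less_imp_le)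
    then have "pdir S (map (\<lambda>v i. of_real (v i)) vs) R (\<lambda>i. u i + z * c v i) \<noteq> 0"
      using Cons.prems by (intro Cons.IH) (auto simp: c_def)
    then show False
      using that by (simp add: p_def poly_pdir_line c_def[abs_def])
  qed
  then have p0: "coeff p 0 \<noteq> 0" by (force simp flip: poly_0_coeff_0)
  obtain \<rho> where \<rho>: "coeff p 1 = coeff p 0 * (\<Sum>i<degree p. \<rho> i)"
    "\<And>i. i < degree p \<Longrightarrow> \<rho> i \<noteq> 0 \<and> poly p (- (1 / \<rho> i)) = 0"
    using complex_poly_factor_at_0[OF p0] by metis
  have Re_pos: "Re (\<rho> i) > 0" if "i < degree p" for i
  proof -
    have "Re (1 / \<rho> i) > 0" using root \<rho>(2)[OF that] by fastforce
    then show ?thesis by (simp add: Re_divide zero_less_divide_iff not_sum_power2_lt_zero)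
  qed
  have pdir_c: "pdir S (map c vs) R (c v) = of_real (pdir S vs R v)"
    by (simp add: c_def[abs_def] pdir_of_real)
  \<comment> \<open>This forces \<open>degree p > 0\<close>; otherwise the sum of the
    \<open>\<rho> i\<close> would be empty and the derivative zero.\<close>
  have "pdir S vs R v > 0"
    using Cons.prems assms(1) by (intro pdir_pos) auto
  then have "coeff p (sum R S - length vs) \<noteq> 0"
    using degree_pdir_line[of S "map c vs" R u "c v"] assms(1) Cons.prems
      pdir_c by (simp add: p_def)
  then have "sum R S - length vs \<le> degree p" by (rule le_degree)
  then have "degree p > 0" using Cons.prems by simp
  then have "Re (\<Sum>i<degree p. \<rho> i) > 0"
    unfolding Re_sum by (intro sum_pos Re_pos) (auto simp: lessThan_empty_iff)
  then have "(\<Sum>i<degree p. \<rho> i) \<noteq> 0" by force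
  then have "coeff p 1 \<noteq> 0" using \<rho>(1) p0 by simp
  then show ?case
    using coeff_1_pdir_line[OF assms(1), of "map c vs" R u "c v"]
    by (simp add: p_def c_def[abs_def])
qed

section \<open>The capacity inequality\<close>

text \<open>By homogeneity the polynomial on a line through the positive orthant is real rooted; AM-GM
  applied to its linear factors then bounds its \<open>k\<close>-th root by the tangent at the origin.\<close>

lemma pdir_tangent_bound:
  fixes u v :: "'i \<Rightarrow> real"
  assumes "finite S" and len: "length vs + k = sum R S" "k > 0"
    and vs: "\<And>w i. w \<in> set vs \<Longrightarrow> i \<in> S \<Longrightarrow> w i > 0"
    and u: "\<And>i. i \<in> S \<Longrightarrow> u i > 0" and v: "\<And>i. i \<in> S \<Longrightarrow> v i > 0" and "t \<ge> 0"
  shows "pdir S vs R (\<lambda>i. u i + t * v i) \<le>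
      pdir S vs R u * (1 + pdir S (v # vs) R u * t / (k * pdir S vs R u)) ^ k"
proof -
  define c where "c w i = complex_of_real (w i)" for w :: "'i \<Rightarrow> real" and i
  define p where "p = pdir_line S (map c vs) R (c u) (c v)"
  define a0 where "a0 = pdir S vs R u"
  define a1 where "a1 = pdir S (v # vs) R u"
  have k: "sum R S - length vs = k" "length vs \<le> sum R S" using len by simp_all
  have a0_pos: "a0 > 0"
    unfolding a0_def using assms(1) len u vs by (intro pdir_pos) auto
  have c: "pdir S (map c ws) R (c w) = of_real (pdir S ws R w)" for ws w
    by (simp add: c_def[abs_def] pdir_of_real)
  have coeff0: "coeff p 0 = of_real a0"
    by (simp add: p_def coeff_0_pdir_line c a0_def)
  have coeff1: "coeff p 1 = of_real a1"
    using c[of "v # vs" u] by (simp add: p_def coeff_1_pdir_line[OF assms(1), unfolded One_nat_def] a1_def)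
  have deg: "degree p = k"
  proof -
    have "pdir S vs R v > 0" using assms(1) len v vs by (intro pdir_pos) auto
    then have "coeff p k \<noteq> 0" "degree p \<le> k"
      using degree_pdir_line[OF assms(1), of "map c vs" R "c u" "c v"] k c[of vs v]
      by (auto simp: p_def)
    then show ?thesis using le_degree by (metis antisym)
  qed
  have root: "Re z < 0 \<and> Im z = 0" if z: "poly p z = 0" for z
  proof (rule ccontr)
    assume neg: "\<not> ?thesis"
    have "z \<noteq> 0" using z coeff0 a0_pos by (auto simp: poly_0_coeff_0)
    have "\<bar>Re z\<bar> \<le> cmod z" by (rule abs_Re_le_cmod)
    moreover have "Re z \<noteq> - cmod z"
    proof
      assume eq: "Re z = - cmod z"
      have "(Re z)\<^sup>2 = (cmod z)\<^sup>2" by (subst eq) simp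
      then have "Im z = 0" using cmod_power2[of z] by (metis add_cancel_left_right zero_eq_power2)
      moreover have "Re z < 0" using \<open>z \<noteq> 0\<close> by (subst eq) simp
      ultimately show False using neg by simp
    qed
    ultimately have pos: "cmod z + Re z > 0" by linarith
    \<comment> \<open>Unless \<open>z\<close> is zero or a negative real, this \<open>w\<close>
      rotates both 1 and \<open>z\<close> into the open right half-plane. Hence
      \<open>w u + w z v\<close> lies there too, and homogeneity carries the nonvanishing back to
      \<open>u + z v\<close>.\<close>
    define w where "w = of_real (cmod z) + cnj z"
    have "w * z = of_real (cmod z) * (z + of_real (cmod z))"
      using complex_norm_square[of z] by (simp add: w_def algebra_simps power2_eq_square)
    then have Re_wz: "Re (w * z) > 0" using pos \<open>z \<noteq> 0\<close> by (simp add: add.commute)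
    have Re_w: "Re w > 0" using pos by (simp add: w_def)
    have "pdir S (map (\<lambda>v i. of_real (v i)) vs) R (\<lambda>i. w * (c u i + z * c v i)) \<noteq> 0"
    proof (rule pdir_nonzero)
      fix i assume i: "i \<in> S"
      have "Re (w * (c u i + z * c v i)) = Re w * u i + Re (w * z) * v i"
        by (simp add: c_def algebra_simps)
      also have "\<dots> > 0" using Re_w Re_wz u[OF i] v[OF i] by (intro add_pos_pos mult_pos_pos)
      finally show "Re (w * (c u i + z * c v i)) > 0" .
    qed (use assms in auto)
    moreover have "pdir S (map (\<lambda>v i. of_real (v i)) vs) R (\<lambda>i. w * (c u i + z * c v i)) =
        w ^ k * pdir S (map c vs) R (\<lambda>i. c u i + z * c v i)"
      using pdir_scale[OF assms(1), of "map c vs" R w "\<lambda>i. c u i + z * c v i"] k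
      by (simp add: c_def[abs_def])
    ultimately show False using z by (simp add: p_def poly_pdir_line)
  qed
  obtain \<rho> where \<rho>: "\<And>z. poly p z = coeff p 0 * (\<Prod>i<k. 1 + \<rho> i * z)"
    "coeff p 1 = coeff p 0 * (\<Sum>i<k. \<rho> i)"
    "\<And>i. i < k \<Longrightarrow> \<rho> i \<noteq> 0 \<and> poly p (- (1 / \<rho> i)) = 0"
    using complex_poly_factor_at_0[of p] coeff0 a0_pos unfolding deg by auto
  define r where "r i = Re (\<rho> i)" for i
  have r: "\<rho> i = of_real (r i)" "r i > 0" if "i < k" for i
  proof -
    have *: "Re (- (1 / \<rho> i)) < 0 \<and> Im (- (1 / \<rho> i)) = 0"
      using root \<rho>(3)[OF that] by blast
    then have Im: "Im (\<rho> i) = 0" using \<rho>(3)[OF that] by (auto simp: Im_divide complex_eq_iff)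
    then show "\<rho> i = of_real (r i)" by (simp add: r_def complex_eq_iff)
    with * show "r i > 0" by (auto simp flip: of_real_divide)
  qed
  have "of_real a1 = complex_of_real (a0 * (\<Sum>i<k. r i))"
    using \<rho>(2) unfolding coeff0 coeff1 by (simp add: r(1))
  then have a1: "a1 = a0 * (\<Sum>i<k. r i)" by (simp only: of_real_eq_iff)
  have "complex_of_real (pdir S vs R (\<lambda>i. u i + t * v i)) = poly p (of_real t)"
    using c[of vs "\<lambda>i. u i + t * v i"] by (simp add: p_def poly_pdir_line c_def[abs_def])
  also have "\<dots> = complex_of_real (a0 * (\<Prod>i<k. 1 + r i * t))"
    unfolding \<rho>(1) coeff0 by (simp add: r(1))
  finally have g: "pdir S vs R (\<lambda>i. u i + t * v i) = a0 * (\<Prod>i<k. 1 + r i * t)"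
    by (simp only: of_real_eq_iff)
  have "(\<Prod>i<k. 1 + r i * t) \<le> ((\<Sum>i<k. 1 + r i * t) / k) ^ k"
    using weighted_AM_GM_nat[of "{..<k}" "\<lambda>_. 1" k "\<lambda>i. 1 + r i * t"] r(2) \<open>t \<ge> 0\<close>
    by (simp add: add_nonneg_nonneg less_imp_le)
  also have "(\<Sum>i<k. 1 + r i * t) / k = 1 + a1 * t / (k * a0)"
    using a0_pos len(2) by (simp add: a1 sum.distrib sum_distrib_right add_divide_distrib)
  finally show ?thesis
    unfolding g a0_def[symmetric] a1_def[symmetric] using a0_pos by simp
qed

text \<open>With one degree left, \<open>pdir S vs R\<close> is a linear form, so its derivative in
  direction \<open>v\<close> equals its value at \<open>v\<close>.\<close>

lemma pdir_last:
  fixes v :: "'i \<Rightarrow> real"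
  assumes "finite S" "sum R S = Suc (length vs)"
  shows "pdir S (v # vs) R (\<lambda>_. 0) = pdir S vs R v"
proof -
  have "poly (pdir_line S vs R (\<lambda>_. 0) v) = poly [:0, pdir S vs R v:]"
    using pdir_scale[OF assms(1), of vs R _ v] assms(2) by (intro ext) (simp add: poly_pdir_line)
  then have "pdir_line S vs R (\<lambda>_. 0) v = [:0, pdir S vs R v:]"
    by (simp add: poly_eq_poly_eq_iff)
  then show ?thesis
    using coeff_1_pdir_line[OF assms(1), of vs R "\<lambda>_. 0" v] by simp
qed

text \<open>Gurvits' capacity inequality. Each step extracts one direction: in the tangent bound the variable
  \<open>z = k a\<^sub>0 / ((k - 1) a\<^sub>1)\<close> is optimal and costs the factor \<open>((k - 1) / k) ^ (k - 1)\<close>.\<close>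

lemma pdir_capacity:
  fixes K :: real
  assumes "finite S" and len: "length vs + length ws = sum R S"
    and pos: "\<And>w i. w \<in> set vs \<union> set ws \<Longrightarrow> i \<in> S \<Longrightarrow> w i > 0"
    and cap: "\<And>t. (\<And>l. l < length ws \<Longrightarrow> t l > 0) \<Longrightarrow>
      K * (\<Prod>l<length ws. t l) \<le> pdir S vs R (\<lambda>i. \<Sum>l<length ws. t l * (ws ! l) i)"
  shows "fact (length ws) / real (length ws) ^ length ws * K \<le> pdir S (rev ws @ vs) R (\<lambda>_. 0)"
  using len pos cap
proof (induction ws arbitrary: vs K)
  case Nil
  then show ?case by simp
next
  case (Cons v ws)
  note cap = Cons.prems(3)
  show ?case
  proof (cases "ws = []")
    \<comment> \<open>With a single direction left the form is linear and the optimal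
      \<open>z\<close> would be infinite; evaluating \<open>cap\<close> at 1 suffices.\<close>
    case True
    then show ?thesis
      using cap[of "\<lambda>_. 1"] Cons.prems(1) pdir_last[OF assms(1), of R vs v] by simp
  next
    case False
    define n where "n = length ws"
    have n: "n > 0" using False by (simp add: n_def)
    define q where "q = real (Suc n) / n"
    have "q > 0" using n by (simp add: q_def)
    define K' where "K' = K / q ^ n"
    have step: "K' * (\<Prod>l<n. t l) \<le> pdir S (v # vs) R (\<lambda>i. \<Sum>l<n. t l * (ws ! l) i)"
      if t: "\<And>l. l < n \<Longrightarrow> t l > 0" for t
    proof -
      define u where "u i = (\<Sum>l<n. t l * (ws ! l) i)" for i
      have u: "u i > 0" if "i \<in> S" for i
        unfolding u_def using n t Cons.prems(2)[OF _ that]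
        by (intro sum_pos mult_pos_pos) (auto simp: n_def lessThan_empty_iff)
      have v: "v i > 0" if "i \<in> S" for i
        using Cons.prems(2)[OF _ that] by auto
      define a0 where "a0 = pdir S vs R u"
      define a1 where "a1 = pdir S (v # vs) R u"
      have "a0 > 0" "a1 > 0"
        unfolding a0_def a1_def using assms(1) Cons.prems u by (auto intro!: pdir_pos simp del: pdir.simps)
      define z where "z = q * a0 / a1"
      have "z > 0" using \<open>q > 0\<close> \<open>a0 > 0\<close> \<open>a1 > 0\<close> by (simp add: z_def)
      have "K * (z * (\<Prod>l<n. t l)) = K * (\<Prod>l<length (v # ws). case_nat z t l)"
        by (simp add: prod.lessThan_Suc_shift n_def del: prod.lessThan_Suc)
      also have "\<dots> \<le> pdir S vs R (\<lambda>i. \<Sum>l<length (v # ws). case_nat z t l * ((v # ws) ! l) i)"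
        using t \<open>z > 0\<close> by (intro cap) (auto simp: n_def split: nat.split)
      also have "(\<lambda>i. \<Sum>l<length (v # ws). case_nat z t l * ((v # ws) ! l) i) = (\<lambda>i. u i + z * v i)"
        by (simp add: sum.lessThan_Suc_shift u_def n_def fun_eq_iff del: sum.lessThan_Suc)
      also have "pdir S vs R (\<lambda>i. u i + z * v i) \<le> a0 * (1 + a1 * z / (Suc n * a0)) ^ Suc n"
        unfolding a0_def a1_def using Cons.prems u v \<open>z > 0\<close>
        by (intro pdir_tangent_bound[OF assms(1)]) (auto simp: n_def)
      also have "a1 * z / (Suc n * a0) = 1 / n"
        using n \<open>a0 > 0\<close> \<open>a1 > 0\<close> by (simp add: z_def q_def del: of_nat_Suc)
      also have "1 + 1 / n = q"
        using n by (simp add: q_def field_simps)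
      finally have "(K * (\<Prod>l<n. t l)) * (q * a0) / a1 \<le> (a0 * q) * q ^ n"
        by (simp add: z_def mult_ac)
      then have "(K * (\<Prod>l<n. t l)) * (q * a0) \<le> (a1 * q ^ n) * (q * a0)"
        using \<open>a1 > 0\<close> by (simp add: pos_divide_le_eq mult_ac)
      then have "K * (\<Prod>l<n. t l) \<le> a1 * q ^ n"
        using \<open>q > 0\<close> \<open>a0 > 0\<close> by (simp add: mult_le_cancel_right)
      then have "K' * (\<Prod>l<n. t l) \<le> a1"
        using \<open>q > 0\<close> by (simp add: K'_def pos_divide_le_eq)
      then show ?thesis unfolding a1_def u_def[abs_def] .
    qed
    have "fact n / real n ^ n * K' \<le> pdir S (rev ws @ v # vs) R (\<lambda>_. 0)"
      unfolding n_def
      by (rule Cons.IH) (use Cons.prems step in \<open>auto simp: n_def simp del: pdir.simps\<close>)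
    \<comment> \<open>The step factors telescope: \<open>n! / n^n * (n / (n+1))^n = n! / (n+1)^n =
      (n+1)! / (n+1)^(n+1)\<close>.\<close>
    also have "fact n / real n ^ n * K' = fact (Suc n) / real (Suc n) ^ Suc n * K"
      using n by (simp add: K'_def q_def power_divide del: of_nat_Suc)
    finally show ?thesis by (simp add: n_def)
  qed
qed

section \<open>Weighted sums over contingency tables\<close>

text \<open>This is \<open>P\<close> of the overview: the coefficient of
  \<open>s ^ R * t ^ C\<close> in \<open>exp (q(s,t))\<close>. When all margins are 1 it is the
  permanent of \<open>A\<close>.\<close>

definition wtab :: "nat \<Rightarrow> nat \<Rightarrow> (nat \<Rightarrow> nat) \<Rightarrow> (nat \<Rightarrow> nat) \<Rightarrow> (nat \<Rightarrow> nat \<Rightarrow> real) \<Rightarrow> real" where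
  "wtab m n R C A = (\<Sum>D\<in>cont_tables m n R C. \<Prod>(i,j)\<in>{..<m}\<times>{..<n}. A i j ^ D i j / fact (D i j))"

lemma cont_tables_entry_le:
  assumes "D \<in> cont_tables m n R C" "i < m" "j < n"
  shows "D i j \<le> R i"
proof -
  have "(\<Sum>j<n. D i j) = R i"
    using assms by (auto simp: cont_tables_def)
  then show "D i j \<le> R i"
    using member_le_sum[of j "{..<n}" "D i"] assms by auto
qed

lemma finite_cont_tables: "finite (cont_tables m n R C)"
proof -
  let ?F = "{f. \<forall>c. (c \<in> {..<m}\<times>{..<n} \<longrightarrow> f c \<in> {..sum R {..<m}}) \<and> (c \<notin> {..<m}\<times>{..<n} \<longrightarrow> f c = 0)}"
  have "finite ?F" by (rule finite_set_of_finite_funs) auto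
  moreover have "cont_tables m n R C \<subseteq> (\<lambda>f i j. f (i, j)) ` ?F"
  proof
    fix D assume D: "D \<in> cont_tables m n R C"
    have "D i j \<le> sum R {..<m}" if "i < m" "j < n" for i j
      using cont_tables_entry_le[OF D that] member_le_sum[of i "{..<m}" R] that by auto
    moreover have "D i j = 0" if "\<not> (i < m \<and> j < n)" for i j
      using D that by (auto simp: cont_tables_def not_less)
    ultimately have "case_prod D \<in> ?F" by auto
    then show "D \<in> (\<lambda>f i j. f (i, j)) ` ?F" by (intro image_eqI[of _ _ "case_prod D"]) auto
  qed
  ultimately show ?thesis by (meson finite_surj)
qed

lemma cont_tables_cong:
  assumes "\<And>i. i < m \<Longrightarrow> R i = R' i" "\<And>j. j < n \<Longrightarrow> C j = C' j"
  shows "cont_tables m n R C = cont_tables m n R' C'"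
  using assms by (auto simp: cont_tables_def)

lemma wtab_transpose: "wtab m n R C A = wtab n m C R (\<lambda>j i. A i j)"
  unfolding wtab_def
proof (rule sum.reindex_bij_witness[of _ "\<lambda>D i j. D j i" "\<lambda>D i j. D j i"])
  fix D assume "D \<in> cont_tables m n R C"
  show "(\<Prod>(j,i)\<in>{..<n}\<times>{..<m}. A i j ^ D i j / fact (D i j)) =
        (\<Prod>(i,j)\<in>{..<m}\<times>{..<n}. A i j ^ D i j / fact (D i j))"
    by (simp add: prod.swap[of _ "{..<m}"] flip: prod.cartesian_product)
qed (auto simp: cont_tables_def)

definition inc :: "nat \<Rightarrow> nat \<Rightarrow> (nat \<Rightarrow> nat \<Rightarrow> nat) \<Rightarrow> nat \<Rightarrow> nat \<Rightarrow> nat" where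
  "inc i j D = (\<lambda>k l. D k l + of_bool (k = i \<and> l = j))"

lemma inc_in_cont_tables:
  assumes "i < m" "j < n" "R i > 0" "C j > 0"
  shows "inc i j D \<in> cont_tables m n R C \<longleftrightarrow> D \<in> cont_tables m n (R(i := R i - 1)) (C(j := C j - 1))"
proof -
  have row: "(\<Sum>l<n. inc i j D k l) = (\<Sum>l<n. D k l) + of_bool (k = i)" for k
    using assms(2) by (cases "k = i") (simp_all add: inc_def sum.distrib of_bool_def)
  have col: "(\<Sum>k<m. inc i j D k l) = (\<Sum>k<m. D k l) + of_bool (l = j)" for l
    using assms(1) by (cases "l = j") (simp_all add: inc_def sum.distrib of_bool_def)
  have r: "(\<Sum>l<n. D k l) + of_bool (k = i) = R k \<longleftrightarrow> (\<Sum>l<n. D k l) = (R(i := R i - 1)) k" for k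
    using assms(3) by auto
  have c: "(\<Sum>k<m. D k l) + of_bool (l = j) = C l \<longleftrightarrow> (\<Sum>k<m. D k l) = (C(j := C j - 1)) l" for l
    using assms(4) by auto
  have z: "inc i j D k l = 0 \<longleftrightarrow> D k l = 0" if "k \<ge> m \<or> l \<ge> n" for k l
    using that assms(1,2) by (auto simp: inc_def)
  show ?thesis
    unfolding cont_tables_def mem_Collect_eq row col
    by (simp add: r c z del: fun_upd_apply cong: imp_cong)
qed

text \<open>Weight each table by \<open>C j\<close>, the sum of its column \<open>j\<close>, and
  remove one unit from cell \<open>(i, j)\<close>: \<open>d * (a^d / d!)\<close> becomes
  \<open>a * (a^(d-1) / (d-1)!)\<close>. In terms of the generating function this is its derivative
  in \<open>t_j\<close>.\<close>

lemma wtab_rec: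
  assumes j: "j < n" and Cj: "C j > 0"
  shows "real (C j) * wtab m n R C A =
    (\<Sum>i<m. if R i = 0 then 0 else A i j * wtab m n (R(i := R i - 1)) (C(j := C j - 1)) A)"
proof -
  define wt where "wt D = (\<Prod>(i,j)\<in>{..<m}\<times>{..<n}. A i j ^ D i j / fact (D i j))" for D :: "nat \<Rightarrow> nat \<Rightarrow> nat"
  have wt_inc: "real (inc i j D i j) * wt (inc i j D) = A i j * wt D" if "i < m" for i D
  proof -
    have mem: "(i, j) \<in> {..<m}\<times>{..<n}" using that j by simp
    have inc: "inc i j D k l = D k l" if "(k, l) \<noteq> (i, j)" for k l
      using that by (simp add: inc_def)
    have "(\<Prod>(k,l)\<in>{..<m}\<times>{..<n} - {(i,j)}. A k l ^ inc i j D k l / fact (inc i j D k l)) =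
        (\<Prod>(k,l)\<in>{..<m}\<times>{..<n} - {(i,j)}. A k l ^ D k l / fact (D k l))"
    proof (rule prod.cong[OF refl])
      fix c assume c: "c \<in> {..<m}\<times>{..<n} - {(i,j)}"
      obtain k l where kl: "c = (k, l)" by (cases c)
      then have "inc i j D k l = D k l" using c inc[of k l] by auto
      then show "(case c of (k, l) \<Rightarrow> A k l ^ inc i j D k l / fact (inc i j D k l)) =
          (case c of (k, l) \<Rightarrow> A k l ^ D k l / fact (D k l))"
        by (simp add: kl)
    qed
    then show ?thesis
      unfolding wt_def by (simp add: prod.remove[OF _ mem] inc_def)
  qed
  have "real (C j) * wtab m n R C A = (\<Sum>D\<in>cont_tables m n R C. (\<Sum>i<m. real (D i j)) * wt D)"
    unfolding wtab_def wt_def sum_distrib_left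
    using j by (intro sum.cong refl) (auto simp: cont_tables_def simp flip: of_nat_sum)
  also have "\<dots> = (\<Sum>i<m. \<Sum>D\<in>cont_tables m n R C. real (D i j) * wt D)"
    unfolding sum_distrib_right by (rule sum.swap)
  also have "\<dots> = (\<Sum>i<m. if R i = 0 then 0 else A i j * wtab m n (R(i := R i - 1)) (C(j := C j - 1)) A)"
  proof (intro sum.cong refl)
    fix i assume "i \<in> {..<m}"
    then have i: "i < m" by simp
    show "(\<Sum>D\<in>cont_tables m n R C. real (D i j) * wt D) =
      (if R i = 0 then 0 else A i j * wtab m n (R(i := R i - 1)) (C(j := C j - 1)) A)"
    proof (cases "R i = 0")
      case True
      then have "real (D i j) * wt D = 0" if "D \<in> cont_tables m n R C" for D
        using cont_tables_entry_le[OF that i j] by simp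
      then have "(\<Sum>D\<in>cont_tables m n R C. real (D i j) * wt D) = 0" by (intro sum.neutral ballI)
      then show ?thesis using True by simp
    next
      case False
      have "(\<Sum>D\<in>cont_tables m n R C. real (D i j) * wt D) =
          (\<Sum>D | D \<in> cont_tables m n R C \<and> D i j > 0. real (D i j) * wt D)"
        by (intro sum.mono_neutral_right finite_cont_tables) auto
      also have "\<dots> = (\<Sum>D\<in>cont_tables m n (R(i := R i - 1)) (C(j := C j - 1)). A i j * wt D)"
      proof (rule sum.reindex_bij_witness[of _ "inc i j" "\<lambda>D k l. D k l - of_bool (k = i \<and> l = j)"])
        fix D assume D: "D \<in> {D \<in> cont_tables m n R C. D i j > 0}"
        show eq: "inc i j (\<lambda>k l. D k l - of_bool (k = i \<and> l = j)) = D"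
          using D by (auto simp: inc_def fun_eq_iff)
        then show "(\<lambda>k l. D k l - of_bool (k = i \<and> l = j)) \<in> cont_tables m n (R(i := R i - 1)) (C(j := C j - 1))"
          using D inc_in_cont_tables[of i m j n R C] i j False Cj by force
        show "A i j * wt (\<lambda>k l. D k l - of_bool (k = i \<and> l = j)) = real (D i j) * wt D"
          using wt_inc[OF i, of "\<lambda>k l. D k l - of_bool (k = i \<and> l = j)"] unfolding eq by simp
      next
        fix D assume D: "D \<in> cont_tables m n (R(i := R i - 1)) (C(j := C j - 1))"
        show "(\<lambda>k l. inc i j D k l - of_bool (k = i \<and> l = j)) = D" by (simp add: inc_def)
        show "inc i j D \<in> {D \<in> cont_tables m n R C. D i j > 0}"
          using D inc_in_cont_tables[of i m j n R C] i j False Cj by (auto simp: inc_def)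
      qed
      finally show ?thesis
        using False by (simp add: wtab_def wt_def sum_distrib_left)
    qed
  qed
  finally show ?thesis .
qed

lemma wtab_zero_margins:
  assumes "\<And>i. i < m \<Longrightarrow> R i = 0" "\<And>j. j < n \<Longrightarrow> C j = 0"
  shows "wtab m n R C A = 1"
proof -
  have "D = (\<lambda>_ _. 0)" if D: "D \<in> cont_tables m n R C" for D
  proof (intro ext)
    show "D i j = 0" for i j
    proof (cases "i < m \<and> j < n")
      case True
      then show ?thesis using cont_tables_entry_le[OF D] assms(1) by fastforce
    next
      case False
      then show ?thesis using D unfolding cont_tables_def by (auto simp: not_less)
    qed
  qed
  moreover have "(\<lambda>_ _. 0) \<in> cont_tables m n R C"
    using assms by (simp add: cont_tables_def)
  ultimately have "cont_tables m n R C = {\<lambda>_ _. 0}" by blast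
  then show ?thesis by (simp add: wtab_def)
qed

lemma prod_fact_upd_pred:
  assumes "finite S" "i \<in> S" "R i > 0"
  shows "(\<Prod>k\<in>S. fact (R k)) = (real (R i) * (\<Prod>k\<in>S. fact ((R(i := R i - 1)) k)) :: real)"
proof -
  have "(\<Prod>k\<in>S - {i}. fact ((R(i := R i - 1)) k)) = (\<Prod>k\<in>S - {i}. fact (R k) :: real)"
    by (intro prod.cong) auto
  then show ?thesis
    using assms by (simp add: prod.remove[OF assms(1,2)] fact_reduce)
qed

text \<open>As many directions as degrees leave a constant, hence no dependence on \<open>u\<close>.
  The recursion of \<open>pdir\<close> along column \<open>j\<close> is that of
  \<open>wtab_rec\<close>, up to the factorials.\<close>

lemma pdir_eq_wtab:
  assumes "set js \<subseteq> {..<n}" "sum R {..<m} = length js"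
  shows "pdir {..<m} (map (\<lambda>j i. A i j) js) R u =
    (\<Prod>i<m. fact (R i)) * (\<Prod>j<n. fact (count_list js j)) * wtab m n R (count_list js) A"
  using assms
proof (induction js arbitrary: R)
  case Nil
  then show ?case by (simp add: wtab_zero_margins)
next
  case (Cons j js)
  let ?C = "count_list (j # js)"
  have upd: "?C(j := ?C j - 1) = count_list js" by auto
  have j: "j < n" "?C j > 0" using Cons.prems by auto
  have "pdir {..<m} (map (\<lambda>j i. A i j) (j # js)) R u =
      (\<Sum>i<m. real (R i) * A i j * pdir {..<m} (map (\<lambda>j i. A i j) js) (R(i := R i - 1)) u)"
    by simp
  also have "\<dots> = (\<Sum>i<m. (\<Prod>i<m. fact (R i)) * (\<Prod>j<n. fact (count_list js j)) *
      (if R i = 0 then 0 else A i j * wtab m n (R(i := R i - 1)) (count_list js) A))"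
  proof (intro sum.cong refl)
    fix i assume "i \<in> {..<m}"
    then have i: "i \<in> {..<m}" "finite {..<m}" by auto
    show "real (R i) * A i j * pdir {..<m} (map (\<lambda>j i. A i j) js) (R(i := R i - 1)) u =
      (\<Prod>i<m. fact (R i)) * (\<Prod>j<n. fact (count_list js j)) *
      (if R i = 0 then 0 else A i j * wtab m n (R(i := R i - 1)) (count_list js) A)"
    proof (cases "R i = 0")
      case False
      then have "sum (R(i := R i - 1)) {..<m} = length js"
        using sum_fun_upd_pred(1)[where R = R, OF i(2,1)] Cons.prems by simp
      then show ?thesis
        using Cons.IH[of "R(i := R i - 1)"] Cons.prems False prod_fact_upd_pred[where R = R, OF i(2,1)]
        by (simp add: mult_ac del: fun_upd_apply)
    qed simp
  qed
  also have "\<dots> = (\<Prod>i<m. fact (R i)) * (\<Prod>j<n. fact (count_list js j)) * (real (?C j) * wtab m n R ?C A)"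
    using wtab_rec[of j n ?C m R A] j unfolding upd sum_distrib_left[symmetric] by simp
  also have "\<dots> = (\<Prod>i<m. fact (R i)) * (\<Prod>k<n. fact (?C k)) * wtab m n R ?C A"
    using prod_fact_upd_pred[of "{..<n}" j ?C] j unfolding upd by simp
  finally show ?case .
qed

section \<open>Upper bounds for \<open>wtab\<close> from row sums and AM-GM\<close>

lemma wtab_nonneg:
  assumes "\<And>i j. i < m \<Longrightarrow> j < n \<Longrightarrow> A i j \<ge> 0"
  shows "wtab m n R C A \<ge> 0"
  unfolding wtab_def using assms by (intro sum_nonneg prod_nonneg) auto

text \<open>The right-hand side is \<open>\<Prod>i. (\<Sum>j. a_ij t_j) ^ R i / fact (R i)\<close>
  at \<open>t = 1\<close>, and \<open>wtab\<close> is one of its nonnegative coefficients. The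
  induction instead sums \<open>wtab_rec\<close> over all columns: that produces the row sums, and
  the bound satisfies the summed recursion with equality.\<close>

lemma wtab_le_row_sums:
  assumes A: "\<And>i j. i < m \<Longrightarrow> j < n \<Longrightarrow> A i j \<ge> 0"
    and sums: "sum R {..<m} = N" "sum C {..<n} = N"
  shows "wtab m n R C A \<le> (\<Prod>i<m. (\<Sum>j<n. A i j) ^ R i / fact (R i))"
  using sums
proof (induction N arbitrary: R C)
  case 0
  then show ?case by (simp add: wtab_zero_margins)
next
  case (Suc N)
  define \<rho> where "\<rho> i = (\<Sum>j<n. A i j)" for i
  define B where "B R = (\<Prod>i<m. \<rho> i ^ R i / fact (R i))" for R
  have \<rho>: "\<rho> i \<ge> 0" if "i < m" for i unfolding \<rho>_def using A that by (intro sum_nonneg) auto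
  have B_nonneg: "B R \<ge> 0" for R unfolding B_def using \<rho> by (intro prod_nonneg) auto
  have B_upd: "\<rho> i * B (R(i := R i - 1)) = real (R i) * B R" if "i < m" "R i > 0" for i
  proof -
    have i: "i \<in> {..<m}" "finite {..<m}" using that by auto
    have "(\<Prod>k\<in>{..<m} - {i}. \<rho> k ^ (R(i := R i - 1)) k / fact ((R(i := R i - 1)) k)) =
        (\<Prod>k\<in>{..<m} - {i}. \<rho> k ^ R k / fact (R k))"
      by (intro prod.cong) auto
    moreover have "\<rho> i * (\<rho> i ^ (R i - 1) / fact (R i - 1)) = real (R i) * (\<rho> i ^ R i / fact (R i))"
      using that by (simp add: fact_reduce[of "R i"] power_eq_if[of _ "R i"])
    ultimately show ?thesis
      unfolding B_def prod.remove[OF i(2,1)] mult.assoc[symmetric] by simp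
  qed
  have IH: "real (C j) * wtab m n R C A \<le> (\<Sum>i<m. if R i = 0 then 0 else A i j * B (R(i := R i - 1)))"
    if j: "j < n" for j
  proof (cases "C j = 0")
    case True
    then show ?thesis using A B_nonneg j by (auto intro!: sum_nonneg)
  next
    case False
    then have Cj: "C j > 0" by simp
    show ?thesis
      unfolding wtab_rec[where C = C, OF j Cj]
    proof (rule sum_mono)
      fix i assume "i \<in> {..<m}"
      then have i: "i \<in> {..<m}" "finite {..<m}" by auto
      show "(if R i = 0 then 0 else A i j * wtab m n (R(i := R i - 1)) (C(j := C j - 1)) A)
          \<le> (if R i = 0 then 0 else A i j * B (R(i := R i - 1)))"
      proof (cases "R i = 0")
        case False
        then have "wtab m n (R(i := R i - 1)) (C(j := C j - 1)) A \<le> B (R(i := R i - 1))"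
          unfolding B_def \<rho>_def
          using Suc.prems j Cj sum_fun_upd_pred(1)[where R = R, OF i(2,1)]
            sum_fun_upd_pred(1)[where R = C, of "{..<n}" j]
          by (intro Suc.IH) simp_all
        then show ?thesis using A i j by (simp add: mult_left_mono)
      qed simp
    qed
  qed
  have "real (Suc N) * wtab m n R C A = (\<Sum>j<n. real (C j) * wtab m n R C A)"
    unfolding sum_distrib_right[symmetric] Suc.prems(2)[symmetric] of_nat_sum by simp
  also have "\<dots> \<le> (\<Sum>j<n. \<Sum>i<m. if R i = 0 then 0 else A i j * B (R(i := R i - 1)))"
    by (intro sum_mono IH) simp
  also have "\<dots> = (\<Sum>i<m. \<Sum>j<n. if R i = 0 then 0 else A i j * B (R(i := R i - 1)))"
    by (rule sum.swap)
  also have "\<dots> = (\<Sum>i<m. real (R i) * B R)"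
  proof (intro sum.cong refl)
    fix i assume "i \<in> {..<m}"
    then show "(\<Sum>j<n. if R i = 0 then 0 else A i j * B (R(i := R i - 1))) = real (R i) * B R"
      using B_upd[of i] by (cases "R i = 0") (simp_all add: \<rho>_def sum_distrib_right)
  qed
  also have "\<dots> = real (Suc N) * B R"
    unfolding sum_distrib_right[symmetric] Suc.prems(1)[symmetric] of_nat_sum by simp
  finally show ?case by (simp add: B_def \<rho>_def)
qed

lemma prod_power_div_fact:
  assumes "\<And>i. i < m \<Longrightarrow> R i > 0"
  shows "(\<Prod>i<m. x i ^ R i / fact (R i)) = omega m R * (\<Prod>i<m. (x i / real (R i)) ^ R i)"
  unfolding omega_def prod.distrib[symmetric] using assms
  by (intro prod.cong refl) (auto simp: power_divide)

lemma omega_pos: "(\<And>i. i < m \<Longrightarrow> R i > 0) \<Longrightarrow> omega m R > 0"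
  unfolding omega_def by (intro prod_pos) auto

lemma wtab_le_omega:
  assumes A: "\<And>i j. i < m \<Longrightarrow> j < n \<Longrightarrow> A i j \<ge> 0"
    and R: "\<And>i. i < m \<Longrightarrow> R i > 0"
    and sums: "sum R {..<m} = N" "sum C {..<n} = N"
  shows "wtab m n R C A \<le> omega m R * ((\<Sum>i<m. \<Sum>j<n. A i j) / N) ^ N"
proof -
  define \<rho> where "\<rho> i = (\<Sum>j<n. A i j)" for i
  have \<rho>: "\<rho> i \<ge> 0" if "i < m" for i unfolding \<rho>_def using A that by (intro sum_nonneg) auto
  have "wtab m n R C A \<le> omega m R * (\<Prod>i<m. (\<rho> i / real (R i)) ^ R i)"
    using wtab_le_row_sums[of m n A R N C] A sums prod_power_div_fact[of m R \<rho>] R by (simp add: \<rho>_def)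
  also have "(\<Prod>i<m. (\<rho> i / real (R i)) ^ R i) \<le> ((\<Sum>i<m. real (R i) * (\<rho> i / real (R i))) / N) ^ N"
    using sums \<rho> by (intro weighted_AM_GM_nat) auto
  also have "(\<Sum>i<m. real (R i) * (\<rho> i / real (R i))) = (\<Sum>i<m. \<rho> i)"
    using R by (intro sum.cong) auto
  finally show ?thesis using omega_pos[of m R] R by (simp add: \<rho>_def mult_left_mono)
qed

lemma wtab_scale:
  "wtab m n R C (\<lambda>i j. A i j * s i * t j) = (\<Prod>i<m. s i ^ R i) * (\<Prod>j<n. t j ^ C j) * wtab m n R C A"
  unfolding wtab_def sum_distrib_left
proof (intro sum.cong refl)
  fix D assume D: "D \<in> cont_tables m n R C"
  have "(\<Prod>i<m. \<Prod>j<n. s i ^ D i j) = (\<Prod>i<m. s i ^ R i)"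
    using D by (intro prod.cong refl) (auto simp: cont_tables_def simp flip: power_sum)
  moreover have "(\<Prod>i<m. \<Prod>j<n. t j ^ D i j) = (\<Prod>j<n. t j ^ C j)"
    using D by (subst prod.swap, intro prod.cong refl) (auto simp: cont_tables_def simp flip: power_sum)
  ultimately show "(\<Prod>(i,j)\<in>{..<m}\<times>{..<n}. (A i j * s i * t j) ^ D i j / fact (D i j)) =
      (\<Prod>i<m. s i ^ R i) * (\<Prod>j<n. t j ^ C j) * (\<Prod>(i,j)\<in>{..<m}\<times>{..<n}. A i j ^ D i j / fact (D i j))"
    by (simp add: power_mult_distrib prod.distrib prod_dividef flip: prod.cartesian_product)
qed

text \<open>Scaling the rows by \<open>s\<close> and the columns by \<open>t\<close> multiplies
  every table's weight by the same monomial, so the bound at \<open>s = t = 1\<close>, for the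
  matrix and for its transpose, gives the bound at all \<open>s, t\<close>.\<close>

lemma wtab_le_min_omega:
  assumes A: "\<And>i j. i < m \<Longrightarrow> j < n \<Longrightarrow> A i j \<ge> 0"
    and R: "\<And>i. i < m \<Longrightarrow> R i > 0" and C: "\<And>j. j < n \<Longrightarrow> C j > 0"
    and sums: "sum R {..<m} = N" "sum C {..<n} = N"
    and s: "\<And>i. i < m \<Longrightarrow> s i > 0" and t: "\<And>j. j < n \<Longrightarrow> t j > 0"
  shows "wtab m n R C A / min (omega m R) (omega n C) * ((\<Prod>i<m. s i ^ R i) * (\<Prod>j<n. t j ^ C j))
    \<le> ((\<Sum>i<m. \<Sum>j<n. A i j * s i * t j) / N) ^ N"
proof -
  define B where "B i j = A i j * s i * t j" for i j
  have B: "B i j \<ge> 0" if "i < m" "j < n" for i j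
    using A[OF that] s[OF that(1)] t[OF that(2)] by (simp add: B_def)
  have "wtab m n R C B \<le> omega m R * ((\<Sum>i<m. \<Sum>j<n. B i j) / N) ^ N"
    using B R sums by (rule wtab_le_omega)
  moreover have "wtab m n R C B \<le> omega n C * ((\<Sum>i<m. \<Sum>j<n. B i j) / N) ^ N"
    unfolding wtab_transpose[of m n R] using wtab_le_omega[of n m "\<lambda>j i. B i j" C N R] B C sums
    by (simp add: sum.swap[of "\<lambda>j i. B i j"])
  ultimately have "wtab m n R C B \<le> min (omega m R) (omega n C) * ((\<Sum>i<m. \<Sum>j<n. B i j) / N) ^ N"
    by (simp add: min_def)
  moreover have "min (omega m R) (omega n C) > 0" using omega_pos R C by (simp add: min_def)
  ultimately have "wtab m n R C B / min (omega m R) (omega n C) \<le> ((\<Sum>i<m. \<Sum>j<n. B i j) / N) ^ N"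
    by (simp add: pos_divide_le_eq mult.commute)
  then show ?thesis
    using wtab_scale[of m n R C A s t] by (simp add: B_def[abs_def] mult_ac)
qed

section \<open>The lower bound for \<open>wtab\<close> from capacity\<close>

lemma exists_count_list: "\<exists>js. \<forall>j. count_list js j = (if j < n then C j else 0)" for C :: "nat \<Rightarrow> nat"
proof (induction n)
  case 0
  then show ?case by (intro exI[of _ "[]"]) simp
next
  case (Suc n)
  then obtain js where js: "\<And>j. count_list js j = (if j < n then C j else 0)" by auto
  have "count_list (replicate k (n::nat)) j = (if j = n then k else 0)" for k j
    by (induction k) auto
  then show ?case
    using js by (intro exI[of _ "js @ replicate (C n) n"]) (auto simp: less_Suc_eq)
qed

lemma card_nth_eq: "card {l. l < length xs \<and> xs ! l = x} = count_list xs x"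
  by (simp add: count_list_eq_length_filter length_filter_conv_card eq_commute[of x])

text \<open>\<open>pdir_capacity\<close> is applied with the columns of \<open>A\<close> as
  directions, column \<open>j\<close> occurring \<open>C j\<close> times. Strict positivity of
  \<open>A\<close> is its positivity condition on directions.\<close>

lemma wtab_capacity_pos:
  fixes \<kappa> :: real
  assumes A: "\<And>i j. i < m \<Longrightarrow> j < n \<Longrightarrow> A i j > 0"
    and R: "\<And>i. i < m \<Longrightarrow> R i > 0" and C: "\<And>j. j < n \<Longrightarrow> C j > 0"
    and sums: "sum R {..<m} = N" "sum C {..<n} = N" and "n > 0" and "\<kappa> \<ge> 0"
    and cap: "\<And>s t. (\<And>i. i < m \<Longrightarrow> s i > 0) \<Longrightarrow> (\<And>j. j < n \<Longrightarrow> t j > 0) \<Longrightarrow>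
      \<kappa> * ((\<Prod>i<m. s i ^ R i) * (\<Prod>j<n. t j ^ C j)) \<le> ((\<Sum>i<m. \<Sum>j<n. A i j * s i * t j) / N) ^ N"
  shows "\<kappa> * (fact N / real N ^ N) * (omega m R * omega n C) \<le> wtab m n R C A"
proof -
  obtain js where js: "\<And>j. count_list js j = (if j < n then C j else 0)"
    using exists_count_list by blast
  have set_js: "set js \<subseteq> {..<n}"
    using js by (metis count_list_0_iff lessThan_iff subsetI)
  have len: "length js = N"
    using sum_count_set[OF set_js] js sums by simp
  have N: "N > 0" using C \<open>n > 0\<close> unfolding sums(2)[symmetric] by (intro sum_pos) (auto simp: lessThan_empty_iff)
  have m: "m > 0" using N sums(1) by (cases m) auto
  define P where "P f B k = (\<Prod>i<k. f i ^ B i)" for f :: "nat \<Rightarrow> real" and B :: "nat \<Rightarrow> nat" and k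
  \<comment> \<open>\<open>R ^ R\<close> comes from optimising over \<open>s\<close>,
    \<open>C ^ C\<close> from merging the parameters of equal columns; divided by the factorials
    they become the omegas.\<close>
  define K where "K = \<kappa> * (P R R m * P C C n)"
  have "fact (length (map (\<lambda>j i. A i j) js)) / real (length (map (\<lambda>j i. A i j) js)) ^ length (map (\<lambda>j i. A i j) js) * K
      \<le> pdir {..<m} (rev (map (\<lambda>j i. A i j) js) @ []) R (\<lambda>_. 0)"
  proof (rule pdir_capacity)
    fix \<tau> :: "nat \<Rightarrow> real"
    assume "\<And>l. l < length (map (\<lambda>j i. A i j) js) \<Longrightarrow> \<tau> l > 0"
    then have \<tau>: "\<tau> l > 0" if "l < N" for l using that len by simp
    define pos where "pos j = {l. l < N \<and> js ! l = j}" for j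
    have pos: "finite (pos j)" "j < n \<Longrightarrow> card (pos j) = C j" for j
      using card_nth_eq[of js j] len js by (auto simp: pos_def)
    have group: "js ! l \<in> {..<n}" if "l \<in> {..<N}" for l
      using subsetD[OF set_js nth_mem[of l js]] that len by simp
    define t where "t j = (\<Sum>l\<in>pos j. \<tau> l)" for j
    have t: "t j > 0" if "j < n" for j
    proof -
      have "pos j \<noteq> {}" using pos(2)[OF that] C[OF that] by auto
      then show ?thesis unfolding t_def using pos \<tau> by (intro sum_pos) (auto simp: pos_def)
    qed
    define \<rho> where "\<rho> i = (\<Sum>j<n. A i j * t j)" for i
    have \<rho>: "\<rho> i > 0" if "i < m" for i
      unfolding \<rho>_def using A[OF that] t \<open>n > 0\<close> by (intro sum_pos mult_pos_pos) (auto simp: lessThan_empty_iff)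
    have \<rho>_eq: "(\<Sum>l<N. \<tau> l * A i (js ! l)) = \<rho> i" for i
    proof -
      have "(\<Sum>l<N. \<tau> l * A i (js ! l)) = (\<Sum>j<n. \<Sum>l | l \<in> {..<N} \<and> js ! l = j. \<tau> l * A i (js ! l))"
        using group by (intro sum.group[symmetric]) auto
      also have "\<dots> = \<rho> i"
        unfolding \<rho>_def t_def pos_def sum_distrib_left by (intro sum.cong) auto
      finally show ?thesis .
    qed
    \<comment> \<open>Copies of one column enter the linear forms only through the sum
      \<open>t j\<close> of their parameters; for a given sum, their product is largest when they
      are equal.\<close>
    have AMGM: "P C C n * (\<Prod>l<N. \<tau> l) \<le> P t C n"
    proof -
      have "(\<Prod>l<N. \<tau> l) = (\<Prod>j<n. \<Prod>l | l \<in> {..<N} \<and> js ! l = j. \<tau> l)"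
        using group by (intro prod.group[symmetric]) auto
      also have "\<dots> = (\<Prod>j<n. \<Prod>l\<in>pos j. \<tau> l)" by (simp add: pos_def)
      also have "\<dots> \<le> (\<Prod>j<n. (t j / C j) ^ C j)"
      proof (rule prod_mono)
        fix j assume "j \<in> {..<n}"
        then have j: "j < n" by simp
        have "(\<Prod>l\<in>pos j. \<tau> l) \<le> (t j / C j) ^ C j"
          using weighted_AM_GM_nat[of "pos j" "\<lambda>_. 1" "C j" \<tau>] pos[of j] j \<tau>
          by (simp add: t_def pos_def less_imp_le)
        moreover have "0 \<le> (\<Prod>l\<in>pos j. \<tau> l)"
          using \<tau> by (intro prod_nonneg) (auto simp: pos_def less_imp_le)
        ultimately show "0 \<le> (\<Prod>l\<in>pos j. \<tau> l) \<and> (\<Prod>l\<in>pos j. \<tau> l) \<le> (t j / C j) ^ C j" by simp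
      qed
      also have "\<dots> = P t C n / P C C n" by (simp add: P_def power_divide prod_dividef)
      finally have "(\<Prod>l<N. \<tau> l) \<le> P t C n / P C C n" .
      moreover have "P C C n > 0" unfolding P_def using C by (intro prod_pos) simp
      ultimately show ?thesis by (simp add: pos_le_divide_eq mult.commute)
    qed
    \<comment> \<open>The choice \<open>s i = R i / \<rho> i\<close> gives row \<open>i\<close> the
      total \<open>R i\<close>, so the right-hand side becomes 1.\<close>
    have "\<kappa> * (P (\<lambda>i. R i / \<rho> i) R m * P t C n) \<le> ((\<Sum>i<m. \<Sum>j<n. A i j * (R i / \<rho> i) * t j) / N) ^ N"
      unfolding P_def using R \<rho> t by (intro cap) auto
    also have "(\<Sum>i<m. \<Sum>j<n. A i j * (R i / \<rho> i) * t j) = (\<Sum>i<m. R i)"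
      unfolding of_nat_sum
    proof (intro sum.cong refl)
      fix i assume "i \<in> {..<m}"
      have "(\<Sum>j<n. A i j * (R i / \<rho> i) * t j) = R i / \<rho> i * \<rho> i"
        unfolding \<rho>_def sum_distrib_left by (intro sum.cong) auto
      then show "(\<Sum>j<n. A i j * (R i / \<rho> i) * t j) = R i" using \<rho>[of i] \<open>i \<in> {..<m}\<close> by simp
    qed
    also have "(real (\<Sum>i<m. R i) / N) ^ N = 1" using sums N by simp
    also have "P (\<lambda>i. R i / \<rho> i) R m = P R R m / P \<rho> R m"
      by (simp add: P_def power_divide prod_dividef)
    finally have "\<kappa> * (P R R m * P t C n) / P \<rho> R m \<le> 1" by simp
    moreover have "P \<rho> R m > 0" unfolding P_def using \<rho> by (intro prod_pos) simp
    ultimately have main: "\<kappa> * (P R R m * P t C n) \<le> P \<rho> R m" by (simp add: pos_divide_le_eq)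
    have "K * (\<Prod>l<N. \<tau> l) = (\<kappa> * P R R m) * (P C C n * (\<Prod>l<N. \<tau> l))" by (simp add: K_def mult_ac)
    also have "\<dots> \<le> (\<kappa> * P R R m) * P t C n"
      using \<open>\<kappa> \<ge> 0\<close> by (intro mult_left_mono AMGM) (auto simp: P_def intro!: mult_nonneg_nonneg prod_nonneg)
    also have "\<dots> \<le> P \<rho> R m" using main by (simp add: mult_ac)
    finally show "K * (\<Prod>l<length (map (\<lambda>j i. A i j) js). \<tau> l)
      \<le> pdir {..<m} [] R (\<lambda>i. \<Sum>l<length (map (\<lambda>j i. A i j) js). \<tau> l * (map (\<lambda>j i. A i j) js ! l) i)"
      using \<rho>_eq len by (simp add: P_def)
  qed (use A set_js len sums in auto)
  then have "fact N / real N ^ N * K \<le> pdir {..<m} (map (\<lambda>j i. A i j) (rev js)) R (\<lambda>_. 0)"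
    by (simp add: len rev_map)
  also have "\<dots> = (\<Prod>i<m. fact (R i)) * (\<Prod>j<n. fact (C j)) * wtab m n R C A"
  proof -
    have "cont_tables m n R (count_list (rev js)) = cont_tables m n R C"
      using js by (intro cont_tables_cong) auto
    then have "wtab m n R (count_list (rev js)) A = wtab m n R C A"
      by (simp add: wtab_def)
    then show ?thesis
      using pdir_eq_wtab[of "rev js" n R m A "\<lambda>_. 0"] set_js len sums js by simp
  qed
  finally have "fact N / real N ^ N * K \<le> wtab m n R C A * ((\<Prod>i<m. fact (R i)) * (\<Prod>j<n. fact (C j)))"
    by (simp add: mult_ac)
  then have "fact N / real N ^ N * K / ((\<Prod>i<m. fact (R i)) * (\<Prod>j<n. fact (C j))) \<le> wtab m n R C A"
    by (subst pos_divide_le_eq) (auto intro!: mult_pos_pos prod_pos)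
  then show ?thesis
    by (simp add: K_def P_def omega_def prod_dividef mult_ac)
qed

lemma tendsto_wtab:
  assumes "\<And>i j. ((\<lambda>e. A e i j) \<longlongrightarrow> A' i j) F"
  shows "((\<lambda>e. wtab m n R C (A e)) \<longlongrightarrow> wtab m n R C A') F"
  unfolding wtab_def split_beta by (intro tendsto_intros assms) auto

text \<open>Zero entries are reached by adding \<open>e\<close> to every entry and letting
  \<open>e\<close> tend to 0; \<open>cap\<close> survives because \<open>q\<close> only grows with
  \<open>A\<close>.\<close>

lemma wtab_capacity:
  fixes \<kappa> :: real
  assumes A: "\<And>i j. i < m \<Longrightarrow> j < n \<Longrightarrow> A i j \<ge> 0"
    and R: "\<And>i. i < m \<Longrightarrow> R i > 0" and C: "\<And>j. j < n \<Longrightarrow> C j > 0"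
    and sums: "sum R {..<m} = N" "sum C {..<n} = N" and "n > 0" and "\<kappa> \<ge> 0"
    and cap: "\<And>s t. (\<And>i. i < m \<Longrightarrow> s i > 0) \<Longrightarrow> (\<And>j. j < n \<Longrightarrow> t j > 0) \<Longrightarrow>
      \<kappa> * ((\<Prod>i<m. s i ^ R i) * (\<Prod>j<n. t j ^ C j)) \<le> ((\<Sum>i<m. \<Sum>j<n. A i j * s i * t j) / N) ^ N"
  shows "\<kappa> * (fact N / real N ^ N) * (omega m R * omega n C) \<le> wtab m n R C A"
proof (rule tendsto_lowerbound)
  have "((\<lambda>e. A i j + e) \<longlongrightarrow> A i j + 0) (at_right 0)" for i j
    by (intro tendsto_intros)
  then show "((\<lambda>e. wtab m n R C (\<lambda>i j. A i j + e)) \<longlongrightarrow> wtab m n R C A) (at_right 0)"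
    by (intro tendsto_wtab) simp
  show "\<forall>\<^sub>F e in at_right 0. \<kappa> * (fact N / real N ^ N) * (omega m R * omega n C) \<le> wtab m n R C (\<lambda>i j. A i j + e)"
    using eventually_at_right_less[of "0::real"]
  proof eventually_elim
    case (elim e)
    show ?case
    proof (rule wtab_capacity_pos[OF _ R C sums \<open>n > 0\<close> \<open>\<kappa> \<ge> 0\<close>])
      show "A i j + e > 0" if "i < m" "j < n" for i j using A[OF that] elim by simp
      fix s t :: "nat \<Rightarrow> real"
      assume s: "\<And>i. i < m \<Longrightarrow> s i > 0" and t: "\<And>j. j < n \<Longrightarrow> t j > 0"
      note cap[OF s t]
      also have "((\<Sum>i<m. \<Sum>j<n. A i j * s i * t j) / N) ^ N \<le> ((\<Sum>i<m. \<Sum>j<n. (A i j + e) * s i * t j) / N) ^ N"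
        using s t A elim
        by (intro power_mono divide_right_mono sum_mono mult_right_mono divide_nonneg_nonneg sum_nonneg mult_nonneg_nonneg)
           (auto simp: less_imp_le)
      finally show "\<kappa> * ((\<Prod>i<m. s i ^ R i) * (\<Prod>j<n. t j ^ C j)) \<le> ((\<Sum>i<m. \<Sum>j<n. (A i j + e) * s i * t j) / N) ^ N"
        by blast
    qed
  qed
qed simp

section \<open>Integrating out the entries\<close>

text \<open>At fixed \<open>s, t\<close> the monomial \<open>s ^ R * t ^ C\<close> is the weighted
  geometric mean of the \<open>s ^ R_k * t ^ C_k\<close>, while AM-GM bounds that of the
  \<open>q_k\<close> by the \<open>q\<close> of the averaged matrix. Hence the product of the
  normalised \<open>wtab\<close> values is an admissible \<open>\<kappa>\<close> for
  \<open>wtab_capacity\<close>.\<close>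

lemma wtab_log_concave:
  fixes A :: "nat \<Rightarrow> nat \<Rightarrow> nat \<Rightarrow> real" and Rs Cs :: "nat \<Rightarrow> nat \<Rightarrow> nat"
  assumes K: "finite K" "\<And>k. k \<in> K \<Longrightarrow> \<alpha> k > 0" "sum \<alpha> K = 1"
    and A: "\<And>k i j. k \<in> K \<Longrightarrow> i < m \<Longrightarrow> j < n \<Longrightarrow> A k i j \<ge> 0"
    and Rs: "\<And>k i. k \<in> K \<Longrightarrow> i < m \<Longrightarrow> Rs k i > 0" "\<And>k. k \<in> K \<Longrightarrow> sum (Rs k) {..<m} = N"
    and Cs: "\<And>k j. k \<in> K \<Longrightarrow> j < n \<Longrightarrow> Cs k j > 0" "\<And>k. k \<in> K \<Longrightarrow> sum (Cs k) {..<n} = N"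
    and R: "\<And>i. i < m \<Longrightarrow> real (R i) = (\<Sum>k\<in>K. \<alpha> k * real (Rs k i))" "\<And>i. i < m \<Longrightarrow> R i > 0"
    and C: "\<And>j. j < n \<Longrightarrow> real (C j) = (\<Sum>k\<in>K. \<alpha> k * real (Cs k j))" "\<And>j. j < n \<Longrightarrow> C j > 0"
    and "n > 0"
  shows "(\<Prod>k\<in>K. (wtab m n (Rs k) (Cs k) (A k) / min (omega m (Rs k)) (omega n (Cs k))) powr \<alpha> k)
    \<le> real N ^ N / fact N / (omega m R * omega n C) * wtab m n R C (\<lambda>i j. \<Sum>k\<in>K. \<alpha> k * A k i j)"
proof -
  define F where "F k = wtab m n (Rs k) (Cs k) (A k) / min (omega m (Rs k)) (omega n (Cs k))" for k
  define B where "B i j = (\<Sum>k\<in>K. \<alpha> k * A k i j)" for i j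
  define \<kappa> where "\<kappa> = (\<Prod>k\<in>K. F k powr \<alpha> k)"
  have F: "F k \<ge> 0" if "k \<in> K" for k
    unfolding F_def using A omega_pos[of m "Rs k"] omega_pos[of n "Cs k"] Rs Cs that
    by (intro divide_nonneg_nonneg wtab_nonneg) (auto simp: min_def less_imp_le)
  have sum_avg: "sum R' {..<l} = N"
    if "\<And>i. i < l \<Longrightarrow> real (R' i) = (\<Sum>k\<in>K. \<alpha> k * real (Rs' k i))" "\<And>k. k \<in> K \<Longrightarrow> sum (Rs' k) {..<l} = N"
    for l and R' :: "nat \<Rightarrow> nat" and Rs' :: "nat \<Rightarrow> nat \<Rightarrow> nat"
  proof -
    have "real (sum R' {..<l}) = (\<Sum>i<l. \<Sum>k\<in>K. \<alpha> k * real (Rs' k i))"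
      using that(1) by simp
    also have "\<dots> = (\<Sum>k\<in>K. \<alpha> k * real (sum (Rs' k) {..<l}))"
      by (subst sum.swap) (simp add: sum_distrib_left)
    also have "\<dots> = real N" using that(2) K(3) by (simp flip: sum_distrib_right)
    finally show ?thesis by (simp only: of_nat_eq_iff)
  qed
  have N: "sum R {..<m} = N" "sum C {..<n} = N"
    using sum_avg[of m R Rs] sum_avg[of n C Cs] R C Rs Cs by auto
  have "N > 0" unfolding N(2)[symmetric] using C(2) \<open>n > 0\<close>
    by (intro sum_pos) (auto simp: lessThan_empty_iff)
  have mono: "(\<Prod>i<l. s i ^ R' i) = (\<Prod>k\<in>K. (\<Prod>i<l. s i ^ Rs' k i) powr \<alpha> k)"
    if "\<And>i. i < l \<Longrightarrow> real (R' i) = (\<Sum>k\<in>K. \<alpha> k * real (Rs' k i))" "\<And>i. i < l \<Longrightarrow> s i > 0"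
    for l R' and Rs' :: "nat \<Rightarrow> nat \<Rightarrow> nat" and s :: "nat \<Rightarrow> real"
  proof -
    have "s i ^ R' i = (\<Prod>k\<in>K. (s i ^ Rs' k i) powr \<alpha> k)" if "i < l" for i
    proof -
      have pos: "s i > 0" using that \<open>\<And>i. i < l \<Longrightarrow> s i > 0\<close> by blast
      then have "s i ^ R' i = s i powr (\<Sum>k\<in>K. \<alpha> k * real (Rs' k i))"
        using that \<open>\<And>i. i < l \<Longrightarrow> real (R' i) = _\<close> by (simp flip: powr_realpow)
      also have "\<dots> = (\<Prod>k\<in>K. s i powr (\<alpha> k * real (Rs' k i)))"
        using pos by (simp add: powr_sum)
      also have "\<dots> = (\<Prod>k\<in>K. (s i ^ Rs' k i) powr \<alpha> k)"
        using pos by (intro prod.cong) (simp_all add: powr_powr mult.commute flip: powr_realpow)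
      finally show ?thesis .
    qed
    then have "(\<Prod>i<l. s i ^ R' i) = (\<Prod>i<l. \<Prod>k\<in>K. (s i ^ Rs' k i) powr \<alpha> k)" by simp
    also have "\<dots> = (\<Prod>k\<in>K. \<Prod>i<l. (s i ^ Rs' k i) powr \<alpha> k)" by (rule prod.swap)
    also have "\<dots> = (\<Prod>k\<in>K. (\<Prod>i<l. s i ^ Rs' k i) powr \<alpha> k)"
      by (intro prod.cong refl prod_powr_distrib[symmetric])
    finally show ?thesis .
  qed
  have "\<kappa> * (fact N / real N ^ N) * (omega m R * omega n C) \<le> wtab m n R C B"
  proof (rule wtab_capacity)
    show "B i j \<ge> 0" if "i < m" "j < n" for i j
      unfolding B_def using A K that by (intro sum_nonneg mult_nonneg_nonneg) (auto simp: less_imp_le)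
    show "\<kappa> \<ge> 0" unfolding \<kappa>_def by (intro prod_nonneg) auto
    fix s t :: "nat \<Rightarrow> real"
    assume s: "\<And>i. i < m \<Longrightarrow> s i > 0" and t: "\<And>j. j < n \<Longrightarrow> t j > 0"
    define q where "q k = (\<Sum>i<m. \<Sum>j<n. A k i j * s i * t j)" for k
    have q: "q k \<ge> 0" if "k \<in> K" for k
      unfolding q_def using A s t that by (intro sum_nonneg mult_nonneg_nonneg) (auto simp: less_imp_le)
    have mon_nonneg: "0 \<le> (\<Prod>i<m. s i ^ Rs k i)" "0 \<le> (\<Prod>j<n. t j ^ Cs k j)" for k
      using s t by (auto intro!: prod_nonneg simp: less_imp_le)
    have mono_s: "(\<Prod>i<m. s i ^ R i) = (\<Prod>k\<in>K. (\<Prod>i<m. s i ^ Rs k i) powr \<alpha> k)"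
      by (rule mono) (use R(1) s in auto)
    have mono_t: "(\<Prod>j<n. t j ^ C j) = (\<Prod>k\<in>K. (\<Prod>j<n. t j ^ Cs k j) powr \<alpha> k)"
      by (rule mono) (use C(1) t in auto)
    have "\<kappa> * ((\<Prod>i<m. s i ^ R i) * (\<Prod>j<n. t j ^ C j)) =
        (\<Prod>k\<in>K. (F k * ((\<Prod>i<m. s i ^ Rs k i) * (\<Prod>j<n. t j ^ Cs k j))) powr \<alpha> k)"
      unfolding \<kappa>_def mono_s mono_t prod.distrib[symmetric]
      using F mon_nonneg by (intro prod.cong refl) (simp add: powr_mult)
    also have "\<dots> \<le> (\<Prod>k\<in>K. ((q k / N) ^ N) powr \<alpha> k)"
    proof (intro prod_mono conjI powr_mono2)
      fix k assume k: "k \<in> K"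
      show "F k * ((\<Prod>i<m. s i ^ Rs k i) * (\<Prod>j<n. t j ^ Cs k j)) \<le> (q k / N) ^ N"
        unfolding F_def q_def using A Rs Cs s t k by (intro wtab_le_min_omega) auto
      show "0 \<le> F k * ((\<Prod>i<m. s i ^ Rs k i) * (\<Prod>j<n. t j ^ Cs k j))"
        using F[OF k] mon_nonneg[of k] by simp
    qed (use K in \<open>auto simp: less_imp_le\<close>)
    also have "\<dots> = (\<Prod>k\<in>K. (q k / N) powr \<alpha> k) ^ N"
      unfolding prod_power_distrib
    proof (intro prod.cong refl)
      fix k assume "k \<in> K"
      then show "((q k / N) ^ N) powr \<alpha> k = ((q k / N) powr \<alpha> k) ^ N"
        using q[of k] \<open>N > 0\<close> by (cases "q k = 0") (simp_all add: zero_power powr_powr mult.commute flip: powr_realpow)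
    qed
    also have "\<dots> \<le> (\<Sum>k\<in>K. \<alpha> k * (q k / N)) ^ N"
      using K q by (intro power_mono weighted_AM_GM prod_nonneg) (auto simp: less_imp_le)
    also have "(\<Sum>k\<in>K. \<alpha> k * (q k / N)) = (\<Sum>k\<in>K. \<alpha> k * q k) / N"
      by (simp add: sum_divide_distrib)
    also have "(\<Sum>k\<in>K. \<alpha> k * q k) = (\<Sum>i<m. \<Sum>j<n. B i j * s i * t j)"
      unfolding q_def B_def sum_distrib_left sum_distrib_right
      by (subst sum.swap, rule sum.cong[OF refl], subst sum.swap) (simp add: mult_ac)
    finally show "\<kappa> * ((\<Prod>i<m. s i ^ R i) * (\<Prod>j<n. t j ^ C j)) \<le> ((\<Sum>i<m. \<Sum>j<n. B i j * s i * t j) / N) ^ N" .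
  qed (use R C N \<open>n > 0\<close> in auto)
  then have "\<kappa> \<le> wtab m n R C B / (fact N / real N ^ N * (omega m R * omega n C))"
    using omega_pos[of m R] omega_pos[of n C] R C \<open>N > 0\<close>
    by (subst pos_le_divide_eq) (simp_all add: mult.assoc)
  then show ?thesis by (simp add: \<kappa>_def F_def B_def[abs_def] mult_ac)
qed

text \<open>Interpolates between \<open>wtab\<close> (\<open>Z = {}\<close>) and \<open>T\<close> (\<open>Z\<close> all cells): the cells in \<open>Z\<close> have been
  integrated out against the exponential density.\<close>

definition hybrid :: "nat \<Rightarrow> nat \<Rightarrow> (nat \<Rightarrow> nat) \<Rightarrow> (nat \<Rightarrow> nat) \<Rightarrow> (nat \<Rightarrow> nat \<Rightarrow> real) \<Rightarrow>
    (nat \<times> nat) set \<Rightarrow> (nat \<times> nat \<Rightarrow> real) \<Rightarrow> real" where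
  "hybrid m n R C W Z x = (\<Sum>D\<in>cont_tables m n R C. \<Prod>c\<in>{..<m}\<times>{..<n}.
     case_prod W c ^ case_prod D c * (if c \<in> Z then 1 else x c ^ case_prod D c / fact (case_prod D c)))"

lemma hybrid_empty: "hybrid m n R C W {} x = wtab m n R C (\<lambda>i j. x (i, j) * W i j)"
  unfolding hybrid_def wtab_def
  by (intro sum.cong prod.cong refl) (auto simp: power_mult_distrib)

lemma hybrid_all: "hybrid m n R C W ({..<m}\<times>{..<n}) x = T m n R C W"
  unfolding hybrid_def T_def prod.cartesian_product
  by (intro sum.cong prod.cong refl) auto

text \<open>For \<open>c\<close> a cell outside \<open>Z\<close>, this is the coefficient of
  \<open>t ^ d / fact d\<close> when \<open>hybrid\<close> is viewed as a polynomial in the variable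
  \<open>t\<close> of cell \<open>c\<close>. Integrating \<open>t\<close> out replaces each
  \<open>t ^ d / fact d\<close> by 1.\<close>

definition slice :: "nat \<Rightarrow> nat \<Rightarrow> (nat \<Rightarrow> nat) \<Rightarrow> (nat \<Rightarrow> nat) \<Rightarrow> (nat \<Rightarrow> nat \<Rightarrow> real) \<Rightarrow>
    (nat \<times> nat) set \<Rightarrow> (nat \<times> nat \<Rightarrow> real) \<Rightarrow> nat \<times> nat \<Rightarrow> nat \<Rightarrow> real" where
  "slice m n R C W Z x c d = (\<Sum>D | D \<in> cont_tables m n R C \<and> case_prod D c = d. \<Prod>c'\<in>{..<m}\<times>{..<n}.
     case_prod W c' ^ case_prod D c' *
       (if c' \<in> insert c Z then 1 else x c' ^ case_prod D c' / fact (case_prod D c')))"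

lemma slice_nonneg:
  assumes "\<And>i j. i < m \<Longrightarrow> j < n \<Longrightarrow> W i j \<ge> 0" "\<And>c. x c > 0"
  shows "slice m n R C W Z x c d \<ge> 0"
  unfolding slice_def using assms by (intro sum_nonneg prod_nonneg) (auto simp: less_imp_le)

lemma slice_sums:
  assumes c: "c \<in> {..<m}\<times>{..<n}" "c \<notin> Z" and M: "sum R {..<m} \<le> M"
  shows "hybrid m n R C W Z (x(c := t)) = (\<Sum>d\<le>M. slice m n R C W Z x c d * (t ^ d / fact d))"
    and "hybrid m n R C W (insert c Z) x = (\<Sum>d\<le>M. slice m n R C W Z x c d)"
proof -
  let ?X = "cont_tables m n R C"
  define g where "g D = (\<Prod>c'\<in>{..<m}\<times>{..<n}. case_prod W c' ^ case_prod D c' *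
       (if c' \<in> insert c Z then 1 else x c' ^ case_prod D c' / fact (case_prod D c')))"
    for D :: "nat \<Rightarrow> nat \<Rightarrow> nat"
  have M': "case_prod D c \<le> M" if "D \<in> ?X" for D
  proof -
    obtain i j where ij: "c = (i, j)" "i < m" "j < n" using c by auto
    have "D i j \<le> R i" using cont_tables_entry_le[OF that ij(2,3)] .
    also have "R i \<le> sum R {..<m}" using ij by (intro member_le_sum) auto
    finally show ?thesis using M ij by simp
  qed
  have group: "(\<Sum>D\<in>?X. h (case_prod D c) * g D) = (\<Sum>d\<le>M. slice m n R C W Z x c d * h d)" for h :: "nat \<Rightarrow> real"
  proof -
    have "(\<Sum>D\<in>?X. h (case_prod D c) * g D) =
        (\<Sum>d\<le>M. \<Sum>D | D \<in> ?X \<and> case_prod D c = d. h (case_prod D c) * g D)"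
      using M' finite_cont_tables by (intro sum.group[symmetric]) auto
    also have "\<dots> = (\<Sum>d\<le>M. slice m n R C W Z x c d * h d)"
      unfolding slice_def g_def[symmetric] sum_distrib_right
      by (intro sum.cong refl) (auto simp: mult.commute)
    finally show ?thesis .
  qed
  show "hybrid m n R C W (insert c Z) x = (\<Sum>d\<le>M. slice m n R C W Z x c d)"
    using group[of "\<lambda>_. 1"] by (simp add: hybrid_def g_def)
  have "(\<Prod>c'\<in>{..<m}\<times>{..<n}. case_prod W c' ^ case_prod D c' *
      (if c' \<in> Z then 1 else (x(c := t)) c' ^ case_prod D c' / fact (case_prod D c'))) =
      t ^ case_prod D c / fact (case_prod D c) * g D" for D
  proof -
    have fin: "finite ({..<m}\<times>{..<n})" by simp
    have "(\<Prod>c'\<in>{..<m}\<times>{..<n} - {c}. case_prod W c' ^ case_prod D c' *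
      (if c' \<in> Z then 1 else (x(c := t)) c' ^ case_prod D c' / fact (case_prod D c'))) =
      (\<Prod>c'\<in>{..<m}\<times>{..<n} - {c}. case_prod W c' ^ case_prod D c' *
       (if c' \<in> insert c Z then 1 else x c' ^ case_prod D c' / fact (case_prod D c')))"
      by (intro prod.cong refl) simp
    then show ?thesis
      unfolding g_def prod.remove[OF fin c(1)] using c(2) by simp
  qed
  then show "hybrid m n R C W Z (x(c := t)) = (\<Sum>d\<le>M. slice m n R C W Z x c d * (t ^ d / fact d))"
    using group[of "\<lambda>d. t ^ d / fact d"] by (simp add: hybrid_def)
qed

text \<open>Some table uses only cells of positive weight, and its term stays positive whichever
  cells are integrated. This is the positive total mass that the transport argument
  requires.\<close>

lemma hybrid_pos:
  assumes W: "\<And>i j. i < m \<Longrightarrow> j < n \<Longrightarrow> W i j \<ge> 0" and x: "\<And>c. x c > 0"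
    and T: "T m n R C W > 0"
  shows "hybrid m n R C W Z x > 0"
proof -
  obtain D where D: "D \<in> cont_tables m n R C" "(\<Prod>i<m. \<Prod>j<n. W i j ^ D i j) \<noteq> 0"
    using T unfolding T_def by (metis (no_types, lifting) less_irrefl sum.neutral)
  have nz: "W i j ^ D i j > 0" if "i < m" "j < n" for i j
    using D(2) W[OF that] that by (force simp: zero_less_power_eq)
  show ?thesis unfolding hybrid_def
  proof (rule sum_pos2[OF finite_cont_tables D(1)])
    show "0 < (\<Prod>c\<in>{..<m} \<times> {..<n}. case_prod W c ^ case_prod D c *
         (if c \<in> Z then 1 else x c ^ case_prod D c / fact (case_prod D c)))"
      using nz x by (intro prod_pos) auto
    show "0 \<le> (\<Prod>c\<in>{..<m} \<times> {..<n}. case_prod W c ^ case_prod D c *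
         (if c \<in> Z then 1 else x c ^ case_prod D c / fact (case_prod D c)))" for D
      using W x by (intro prod_nonneg) (auto simp: less_imp_le)
  qed
qed

text \<open>Induction over the integrated cells. With the variables of cell \<open>c\<close> left
  free, the induction hypothesis is precisely the pointwise assumption of
  \<open>prekopa_leindler_exp\<close>, whose conclusion integrates \<open>c\<close> out.\<close>

lemma hybrid_prekopa_leindler:
  fixes x :: "nat \<Rightarrow> nat \<times> nat \<Rightarrow> real" and M :: "nat \<Rightarrow> real"
  assumes K: "finite K" "\<And>k. k \<in> K \<Longrightarrow> \<alpha> k > 0" "sum \<alpha> K = 1"
    and W: "\<And>i j. i < m \<Longrightarrow> j < n \<Longrightarrow> W i j \<ge> 0"
    and T: "\<And>k. k \<in> K \<Longrightarrow> T m n (Rs k) (Cs k) W > 0" and M: "\<And>k. k \<in> K \<Longrightarrow> M k > 0" and "c0 \<ge> 0"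
    and base: "\<And>x. (\<And>k c. k \<in> K \<Longrightarrow> x k c > 0) \<Longrightarrow>
      (\<Prod>k\<in>K. (wtab m n (Rs k) (Cs k) (\<lambda>i j. x k (i, j) * W i j) / M k) powr \<alpha> k)
        \<le> c0 * wtab m n R C (\<lambda>i j. (\<Sum>k\<in>K. \<alpha> k * x k (i, j)) * W i j)"
    and Z: "finite Z" "Z \<subseteq> {..<m}\<times>{..<n}"
    and x: "\<And>k c. k \<in> K \<Longrightarrow> x k c > 0"
  shows "(\<Prod>k\<in>K. (hybrid m n (Rs k) (Cs k) W Z (x k) / M k) powr \<alpha> k)
     \<le> c0 * hybrid m n R C W Z (\<lambda>c. \<Sum>k\<in>K. \<alpha> k * x k c)"
  using Z x
proof (induction Z arbitrary: x rule: finite_induct)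
  case empty
  then show ?case using base[of x] by (simp add: hybrid_empty)
next
  case (insert c Z)
  have c: "c \<in> {..<m}\<times>{..<n}" "c \<notin> Z" "Z \<subseteq> {..<m}\<times>{..<n}" using insert by auto
  \<comment> \<open>\<open>prekopa_leindler_exp\<close> takes one degree bound for all its
    polynomials.\<close>
  define B where "B = sum R {..<m} + (\<Sum>k\<in>K. sum (Rs k) {..<m})"
  have B: "sum R {..<m} \<le> B" "k \<in> K \<Longrightarrow> sum (Rs k) {..<m} \<le> B" for k
    using member_le_sum[of k K "\<lambda>k. sum (Rs k) {..<m}"] K(1) by (auto simp: B_def)
  define y where "y = (\<lambda>c. \<Sum>k\<in>K. \<alpha> k * x k c)"
  have "K \<noteq> {}" using K(3) by auto
  then have y: "y c > 0" for c
    unfolding y_def using K insert.prems(2) by (intro sum_pos) auto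
  have "(\<Prod>k\<in>K. (\<Sum>d\<le>B. slice m n (Rs k) (Cs k) W Z (x k) c d / M k) powr \<alpha> k)
      \<le> (\<Sum>d\<le>B. c0 * slice m n R C W Z y c d)"
  proof (rule prekopa_leindler_exp)
    show "0 \<le> slice m n (Rs k) (Cs k) W Z (x k) c d / M k" if "k \<in> K" for k d
      using slice_nonneg[of m n W "x k" "Rs k" "Cs k" Z c d] W insert.prems(2) M that
      by (simp add: less_imp_le)
    show "0 < (\<Sum>d\<le>B. slice m n (Rs k) (Cs k) W Z (x k) c d / M k)" if k: "k \<in> K" for k
      unfolding sum_divide_distrib[symmetric] slice_sums(2)[OF c(1,2) B(2)[OF k], symmetric]
      using hybrid_pos[OF W _ T[OF k], of "x k"] insert.prems(2) M k by simp
    show "0 \<le> c0 * slice m n R C W Z y c d" for d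
      using slice_nonneg[of m n W y] W y \<open>c0 \<ge> 0\<close> by simp
    fix t :: "nat \<Rightarrow> real"
    assume t: "\<And>k. k \<in> K \<Longrightarrow> t k > 0"
    have "(\<Prod>k\<in>K. (hybrid m n (Rs k) (Cs k) W Z ((x k)(c := t k)) / M k) powr \<alpha> k)
     \<le> c0 * hybrid m n R C W Z (\<lambda>c'. \<Sum>k\<in>K. \<alpha> k * ((x k)(c := t k)) c')"
      using c(3) t insert.prems(2) by (intro insert.IH) auto
    also have "(\<lambda>c'. \<Sum>k\<in>K. \<alpha> k * ((x k)(c := t k)) c') = y(c := \<Sum>k\<in>K. \<alpha> k * t k)"
      by (auto simp: y_def fun_eq_iff)
    also have "c0 * hybrid m n R C W Z (y(c := \<Sum>k\<in>K. \<alpha> k * t k)) =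
        (\<Sum>d\<le>B. c0 * slice m n R C W Z y c d * ((\<Sum>k\<in>K. \<alpha> k * t k) ^ d / fact d))"
      unfolding slice_sums(1)[OF c(1,2) B(1)] sum_distrib_left by (simp add: mult_ac)
    also have "(\<Prod>k\<in>K. (hybrid m n (Rs k) (Cs k) W Z ((x k)(c := t k)) / M k) powr \<alpha> k) =
        (\<Prod>k\<in>K. (\<Sum>d\<le>B. slice m n (Rs k) (Cs k) W Z (x k) c d / M k * (t k ^ d / fact d)) powr \<alpha> k)"
      using slice_sums(1)[OF c(1,2) B(2)]
      by (intro prod.cong refl) (simp add: sum_divide_distrib mult_ac del: fun_upd_apply)
    finally show "(\<Prod>k\<in>K. (\<Sum>d\<le>B. slice m n (Rs k) (Cs k) W Z (x k) c d / M k * (t k ^ d / fact d)) powr \<alpha> k)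
        \<le> (\<Sum>d\<le>B. c0 * slice m n R C W Z y c d * ((\<Sum>k\<in>K. \<alpha> k * t k) ^ d / fact d))" .
  qed (use K in auto)
  then show ?case
    using slice_sums(2)[OF c(1,2) B(2)] slice_sums(2)[OF c(1,2) B(1)]
    by (simp add: y_def flip: sum_divide_distrib sum_distrib_left)
qed

theorem theorem2p1:
  fixes m n p N :: nat
    and W :: "nat \<Rightarrow> nat \<Rightarrow> real"
    and Rs Cs :: "nat \<Rightarrow> nat \<Rightarrow> nat"
    and \<alpha> :: "nat \<Rightarrow> real"
    and R C :: "nat \<Rightarrow> nat"
  assumes "m \<ge> 1" and "n \<ge> 1"
    and W_nonneg: "\<And>i j. i < m \<Longrightarrow> j < n \<Longrightarrow> W i j \<ge> 0"
    and Rs_pos: "\<And>k i. k < p \<Longrightarrow> i < m \<Longrightarrow> Rs k i > 0"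
    and Cs_pos: "\<And>k j. k < p \<Longrightarrow> j < n \<Longrightarrow> Cs k j > 0"
    and Rs_size: "\<And>k. k < p \<Longrightarrow> vsize m (Rs k) = N"
    and Cs_size: "\<And>k. k < p \<Longrightarrow> vsize n (Cs k) = N"
    and alpha_nonneg: "\<And>k. k < p \<Longrightarrow> \<alpha> k \<ge> 0"
    and alpha_sum: "(\<Sum>k<p. \<alpha> k) = 1"
    and R_def: "\<And>i. i < m \<Longrightarrow> real (R i) = (\<Sum>k<p. \<alpha> k * real (Rs k i))"
    and C_def: "\<And>j. j < n \<Longrightarrow> real (C j) = (\<Sum>k<p. \<alpha> k * real (Cs k j))"
    and R_pos: "\<And>i. i < m \<Longrightarrow> R i > 0"
    and C_pos: "\<And>j. j < n \<Longrightarrow> C j > 0"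
  shows "real N ^ N / fact N * (T m n R C W / (omega m R * omega n C))
         \<ge> (\<Prod>k<p. rpow (T m n (Rs k) (Cs k) W / min (omega m (Rs k)) (omega n (Cs k))) (\<alpha> k))"
proof -
  \<comment> \<open>Indices of weight 0 contribute the factor 1 by \<open>rpow\<close>, but
    \<open>powr\<close> would give 0 at base 0, and the transport requires positive weights.\<close>
  define K where "K = {k. k < p \<and> \<alpha> k \<noteq> 0}"
  define M where "M k = min (omega m (Rs k)) (omega n (Cs k))" for k
  define c0 where "c0 = real N ^ N / fact N / (omega m R * omega n C)"
  have K: "finite K" "K \<subseteq> {..<p}" "\<And>k. k \<in> K \<Longrightarrow> \<alpha> k > 0"
    using alpha_nonneg by (auto simp: K_def order.not_eq_order_implies_strict)
  have sum_K: "(\<Sum>k\<in>K. \<alpha> k * f k) = (\<Sum>k<p. \<alpha> k * f k)" for f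
    by (rule sum.mono_neutral_left) (auto simp: K_def)
  have "c0 \<ge> 0"
    using omega_pos[of m R] omega_pos[of n C] R_pos C_pos by (simp add: c0_def less_imp_le)
  have M: "M k > 0" if "k \<in> K" for k
    using omega_pos[of m "Rs k"] omega_pos[of n "Cs k"] Rs_pos Cs_pos K(2) that by (auto simp: M_def)
  have T_nonneg: "T m n R' C' W \<ge> 0" for R' C'
    unfolding T_def using W_nonneg by (intro sum_nonneg prod_nonneg) auto
  have "(\<Prod>k<p. rpow (T m n (Rs k) (Cs k) W / M k) (\<alpha> k)) =
      (\<Prod>k\<in>K. (T m n (Rs k) (Cs k) W / M k) powr \<alpha> k)"
    by (rule prod.mono_neutral_cong_right) (auto simp: K_def rpow_def)
  also have "\<dots> \<le> c0 * T m n R C W"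
  proof (cases "\<exists>k\<in>K. T m n (Rs k) (Cs k) W = 0")
    \<comment> \<open>A vanishing factor has no mass to transport, but then the left-hand side is
      0.\<close>
    case True
    then have "(\<Prod>k\<in>K. (T m n (Rs k) (Cs k) W / M k) powr \<alpha> k) = 0"
      using K(1) by (auto simp: prod_zero_iff)
    then show ?thesis using \<open>c0 \<ge> 0\<close> T_nonneg by simp
  next
    case False
    \<comment> \<open>With every cell integrated out, \<open>hybrid\<close> no longer depends on its
      point; 1 is an arbitrary positive choice.\<close>
    have "(\<Prod>k\<in>K. (hybrid m n (Rs k) (Cs k) W ({..<m}\<times>{..<n}) (\<lambda>_. 1) / M k) powr \<alpha> k)
        \<le> c0 * hybrid m n R C W ({..<m}\<times>{..<n}) (\<lambda>c. \<Sum>k\<in>K. \<alpha> k * 1)"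
    proof (rule hybrid_prekopa_leindler)
      show "T m n (Rs k) (Cs k) W > 0" if "k \<in> K" for k
        using False T_nonneg that by (auto simp: order.not_eq_order_implies_strict)
      fix x :: "nat \<Rightarrow> nat \<times> nat \<Rightarrow> real"
      assume x: "\<And>k c. k \<in> K \<Longrightarrow> x k c > 0"
      have "(\<Prod>k\<in>K. (wtab m n (Rs k) (Cs k) (\<lambda>i j. x k (i, j) * W i j) / M k) powr \<alpha> k)
          \<le> c0 * wtab m n R C (\<lambda>i j. \<Sum>k\<in>K. \<alpha> k * (x k (i, j) * W i j))"
        unfolding M_def c0_def
        using K x W_nonneg Rs_pos Cs_pos Rs_size Cs_size R_pos C_pos R_def C_def alpha_sum
          sum_K[of "\<lambda>_. 1"] \<open>n \<ge> 1\<close>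
        by (intro wtab_log_concave) (auto simp: vsize_def sum_K less_imp_le)
      then show "(\<Prod>k\<in>K. (wtab m n (Rs k) (Cs k) (\<lambda>i j. x k (i, j) * W i j) / M k) powr \<alpha> k)
          \<le> c0 * wtab m n R C (\<lambda>i j. (\<Sum>k\<in>K. \<alpha> k * x k (i, j)) * W i j)"
        by (simp add: sum_distrib_right mult.assoc)
    qed (use K M \<open>c0 \<ge> 0\<close> W_nonneg alpha_sum sum_K[of "\<lambda>_. 1"] in auto)
    then show ?thesis by (simp add: hybrid_all)
  qed
  finally show ?thesis by (simp add: M_def c0_def)
qed

end
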